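(* Let $n$ be a positive integer, let $A, B, C$ be $n$-dimensional vector spaces over $\mathbb{C}$, and let $$\underline{\mathbf{Q}}_{\max} := \overline{\{[T] \in \mathbb{P}(A \otimes B \otimes C) : \underline{\mathbf{Q}}(T) = n\}}$$ be the closure, in the projective space $\mathbb{P}(A\otimes B\otimes C)$, of the set of tensors of maximal border subrank. Then $$\dim(\underline{\mathbf{Q}}_{\max}) \geq \frac{2n^3 + 3n^2 - 2n - 3}{3}.$$
   Context: Let $\{a_i\}_{i=1}^n$, $\{b_i\}_{i=1}^n$, $\{c_i\}_{i=1}^n$ be bases of $A$, $B$, $C$ respectively. For a positive integer $r \le n$, write $M_{\langle 1\rangle}^{\oplus r} := \sum_{i=1}^r a_i \otimes b_i \otimes c_i \in A\otimes B\otimes C$. The group $\mathrm{GL}(A)\times \mathrm{GL}(B)\times \mathrm{GL}(C)$ acts on $A\otimes B\otimes C$ by $(f,g,h)\cdot(a\otimes b\otimes c) = f(a)\otimes g(b)\otimes h(c)$, extended linearly. The border subrank $\underline{\mathbf{Q}}(T)$ of a tensor $T\in A\otimes B\otimes C$ is the maximal positive integer $s \le n$ such that $$M_{\langle 1\rangle}^{\oplus s} \in \overline{(\mathrm{GL}(A)\times \mathrm{GL}(B)\times \mathrm{GL}(C))\cdot T},$$ where the bar denotes closure in $A\otimes B\otimes C$. This is independent of the choice of bases and invariant under multiplying $T$ by a nonzero scalar. In particular $\underline{\mathbf{Q}}(T)=n$ if and only if $M_{\langle 1\rangle}^{\oplus n}$ lies in this orbit closure. $\dim$ denotes the dimension as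 a (possibly reducible) projective variety. *)

theory Defs
  imports "HOL-Analysis.Analysis"
begin

section \<open>Bases and tensor products of complex vector spaces\<close>

text \<open>
  A complex vector space is a type of class \<open>ab_group_add\<close> with a scalar multiplication \<open>s\<close>
  satisfying \<open>vector_space s\<close>.
  The constant \<open>Vector_Spaces.linear\<close> carries the \<open>vector_space\<close> axioms of both sides.
\<close>

definition basis_family :: "(complex \<Rightarrow> 'a::ab_group_add \<Rightarrow> 'a) \<Rightarrow> nat \<Rightarrow> (nat \<Rightarrow> 'a) \<Rightarrow> bool" where
  "basis_family s n e \<longleftrightarrow>
     inj_on e {1..n} \<and> \<not> module.dependent s (e ` {1..n}) \<and> module.span s (e ` {1..n}) = UNIV"

definition trilinear ::
  "(complex \<Rightarrow> 'a::ab_group_add \<Rightarrow> 'a) \<Rightarrow> (complex \<Rightarrow> 'b::ab_group_add \<Rightarrow> 'b) \<Rightarrow>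
   (complex \<Rightarrow> 'c::ab_group_add \<Rightarrow> 'c) \<Rightarrow> (complex \<Rightarrow> 'w::ab_group_add \<Rightarrow> 'w) \<Rightarrow>
   ('a \<Rightarrow> 'b \<Rightarrow> 'c \<Rightarrow> 'w) \<Rightarrow> bool" where
  "trilinear sA sB sC sW f \<longleftrightarrow>
     (\<forall>y z. Vector_Spaces.linear sA sW (\<lambda>x. f x y z)) \<and>
     (\<forall>x z. Vector_Spaces.linear sB sW (\<lambda>y. f x y z)) \<and>
     (\<forall>x y. Vector_Spaces.linear sC sW (\<lambda>z. f x y z))"

text \<open>
  \<open>tensor_product sA sB sC sV \<tau>\<close> says that \<open>V\<close> together with \<open>\<tau> x y z = x \<otimes> y \<otimes> z\<close> is the tensor
  product of \<open>A\<close>, \<open>B\<close> and \<open>C\<close>.  A definition cannot quantify over the type of the target space in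
  the universal property, so it is required for the target \<open>\<complex>\<close>; the lemma
  \<open>tensor_product_universal\<close> below derives it for an arbitrary target.
\<close>

definition tensor_product ::
  "(complex \<Rightarrow> 'a::ab_group_add \<Rightarrow> 'a) \<Rightarrow> (complex \<Rightarrow> 'b::ab_group_add \<Rightarrow> 'b) \<Rightarrow>
   (complex \<Rightarrow> 'c::ab_group_add \<Rightarrow> 'c) \<Rightarrow> (complex \<Rightarrow> 'v::ab_group_add \<Rightarrow> 'v) \<Rightarrow>
   ('a \<Rightarrow> 'b \<Rightarrow> 'c \<Rightarrow> 'v) \<Rightarrow> bool" where
  "tensor_product sA sB sC sV \<tau> \<longleftrightarrow>
     trilinear sA sB sC sV \<tau> \<and>
     (\<forall>f. trilinear sA sB sC (*) f \<longrightarrow>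
        (\<exists>!\<phi>. Vector_Spaces.linear sV (*) \<phi> \<and> (\<forall>x y z. \<phi> (\<tau> x y z) = f x y z)))"

lemma linear_functional_extend:
  fixes s :: "complex \<Rightarrow> 'v::ab_group_add \<Rightarrow> 'v"
  assumes "vector_space s" "\<not> module.dependent s B"
  shows "\<exists>\<phi>. Vector_Spaces.linear s (*) \<phi> \<and> (\<forall>x\<in>B. \<phi> x = g x)"
proof -
  interpret P: vector_space_pair s "(*) :: complex \<Rightarrow> complex \<Rightarrow> complex"
    using assms(1) vector_space_over_itself.vector_space_axioms
    by (simp add: vector_space_pair_def)
  show ?thesis
    using P.linear_independent_extend[OF assms(2)] by blast
qed

lemma linear_functionals_separate:
  fixes s :: "complex \<Rightarrow> 'v::ab_group_add \<Rightarrow> 'v"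
  assumes "vector_space s" "v \<noteq> w"
  shows "\<exists>\<phi>. Vector_Spaces.linear s (*) \<phi> \<and> \<phi> v \<noteq> \<phi> w"
proof -
  interpret V: vector_space s by fact
  have "V.independent {v - w}"
    using assms(2) by simp
  then obtain \<phi> where \<phi>: "Vector_Spaces.linear s (*) \<phi>" "\<phi> (v - w) = 1"
    using linear_functional_extend[OF assms(1), of "{v - w}" "\<lambda>_. 1"] by auto
  interpret L: Vector_Spaces.linear s "(*)" \<phi> by fact
  have "\<phi> v - \<phi> w = 1"
    using \<phi>(2) by (simp add: L.diff)
  then show ?thesis
    using \<phi>(1) by (intro exI[of _ \<phi>]) auto
qed

lemma linear_compose_trilinear:
  assumes "trilinear sA sB sC sW f" "Vector_Spaces.linear sW sU \<psi>"
  shows "trilinear sA sB sC sU (\<lambda>x y z. \<psi> (f x y z))"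
proof -
  have *: "\<And>h. Vector_Spaces.linear sA sW h \<Longrightarrow> Vector_Spaces.linear sA sU (\<lambda>x. \<psi> (h x))"
    "\<And>h. Vector_Spaces.linear sB sW h \<Longrightarrow> Vector_Spaces.linear sB sU (\<lambda>x. \<psi> (h x))"
    "\<And>h. Vector_Spaces.linear sC sW h \<Longrightarrow> Vector_Spaces.linear sC sU (\<lambda>x. \<psi> (h x))"
    using Vector_Spaces.linear_compose[OF _ assms(2)] by (simp_all add: o_def)
  show ?thesis
    using assms(1) unfolding trilinear_def by (auto intro!: *)
qed

lemma tensor_product_span:
  assumes "tensor_product sA sB sC sV \<tau>"
  shows "module.span sV {\<tau> x y z |x y z. True} = UNIV"
proof (rule ccontr)
  have lin: "Vector_Spaces.linear sA sV (\<lambda>x. \<tau> x y z)" for y z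
    using assms by (simp add: tensor_product_def trilinear_def)
  interpret V: vector_space sV
    using lin by (simp add: Vector_Spaces.linear_def)
  let ?P = "{\<tau> x y z |x y z. True}"
  assume "V.span ?P \<noteq> UNIV"
  then obtain v where v: "v \<notin> V.span ?P" by blast
  obtain B where B: "B \<subseteq> ?P" "V.independent B" "?P \<subseteq> V.span B"
    using V.maximal_independent_subset[of ?P] by blast
  have vB: "v \<notin> V.span B"
    using v B(1) V.span_mono by blast
  then have "V.independent (insert v B)"
    using B(2) by (simp add: V.independent_insert)
  then obtain \<phi> where \<phi>: "Vector_Spaces.linear sV (*) \<phi>"
      "\<And>x. x \<in> insert v B \<Longrightarrow> \<phi> x = (if x = v then 1 else 0)"
    using linear_functional_extend[OF V.vector_space_axioms,
        of "insert v B" "\<lambda>x. if x = v then 1 else 0"] by blast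
  interpret L: Vector_Spaces.linear sV "(*)" \<phi> by fact
  have B0: "\<phi> x = 0" if "x \<in> B" for x
    using \<phi>(2)[of x] that vB V.span_base[of v B] by auto
  have "\<phi> x = 0" if "x \<in> V.span B" for x
    using L.eq_0_on_span[OF B0 that] .
  then have \<phi>P: "\<phi> (\<tau> x y z) = 0" for x y z
    using B(3) by blast
  have tri: "trilinear sA sB sC (*) (\<lambda>x y z. \<phi> (\<tau> x y z))"
    using assms by (intro linear_compose_trilinear[OF _ \<phi>(1)]) (simp add: tensor_product_def)
  have zero: "Vector_Spaces.linear sV (*) (\<lambda>_. 0 :: complex)"
    using V.vector_space_axioms vector_space_over_itself.vector_space_axioms
    by (simp add: Vector_Spaces.linear_iff)
  have "\<phi> = (\<lambda>_. 0)"
  proof -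
    have "\<exists>!\<psi>. Vector_Spaces.linear sV (*) \<psi> \<and> (\<forall>x y z. \<psi> (\<tau> x y z) = \<phi> (\<tau> x y z))"
      using assms tri unfolding tensor_product_def by (elim conjE allE impE)
    moreover have "\<forall>x y z. (\<lambda>_. 0) (\<tau> x y z) = \<phi> (\<tau> x y z)"
      by (simp add: \<phi>P)
    ultimately show ?thesis
      using \<phi>(1) zero by (elim ex1E) (metis (no_types, lifting))
  qed
  then show False
    using \<phi>(2)[of v] by simp
qed

lemma tensor_product_universal:
  assumes T: "tensor_product sA sB sC sV \<tau>" and f: "trilinear sA sB sC sW f"
  shows "\<exists>!F. Vector_Spaces.linear sV sW F \<and> (\<forall>x y z. F (\<tau> x y z) = f x y z)"
proof -
  have "Vector_Spaces.linear sA sV (\<lambda>x. \<tau> x y z)" "Vector_Spaces.linear sA sW (\<lambda>x. f x y z)"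
    for y z using assms by (simp_all add: tensor_product_def trilinear_def)
  then interpret VW: vector_space_pair sV sW
    by (simp add: Vector_Spaces.linear_def vector_space_pair_def)
  interpret VC: vector_space_pair sV "(*) :: complex \<Rightarrow> complex \<Rightarrow> complex" ..
  let ?P = "{\<tau> x y z |x y z. True}"
  have span: "VW.vs1.span ?P = UNIV"
    using tensor_product_span[OF T] .
  obtain B where B: "B \<subseteq> ?P" "VW.vs1.independent B" "?P \<subseteq> VW.vs1.span B"
    using VW.vs1.maximal_independent_subset[of ?P] by blast
  have spanB: "VW.vs1.span B = UNIV"
    using VW.vs1.span_minimal[OF B(3) VW.vs1.subspace_span] unfolding span by blast
  have "\<forall>b\<in>B. \<exists>w. \<exists>x y z. b = \<tau> x y z \<and> w = f x y z"
    using B(1) by blast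
  then obtain g where g: "\<And>b. b \<in> B \<Longrightarrow> \<exists>x y z. b = \<tau> x y z \<and> g b = f x y z"
    using bchoice[of B "\<lambda>b w. \<exists>x y z. b = \<tau> x y z \<and> w = f x y z"] by blast
  obtain F where F: "Vector_Spaces.linear sV sW F" "\<And>b. b \<in> B \<Longrightarrow> F b = g b"
    using VW.linear_independent_extend[OF B(2), of g] by blast
  have Ff: "F (\<tau> x y z) = f x y z" for x y z
  proof (rule ccontr)
    assume "F (\<tau> x y z) \<noteq> f x y z"
    then obtain \<psi> where \<psi>: "Vector_Spaces.linear sW (*) \<psi>" "\<psi> (F (\<tau> x y z)) \<noteq> \<psi> (f x y z)"
      using linear_functionals_separate[OF VW.vs2.vector_space_axioms] by blast
    obtain \<phi> where \<phi>: "Vector_Spaces.linear sV (*) \<phi>" "\<And>x y z. \<phi> (\<tau> x y z) = \<psi> (f x y z)"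
      using T linear_compose_trilinear[OF f \<psi>(1)] unfolding tensor_product_def by meson
    have "Vector_Spaces.linear sV (*) (\<psi> \<circ> F)"
      using Vector_Spaces.linear_compose[OF F(1) \<psi>(1)] .
    moreover have "\<phi> b = (\<psi> \<circ> F) b" if "b \<in> B" for b
      using g[OF that] F(2)[OF that] \<phi>(2) by auto
    ultimately have "\<phi> v = (\<psi> \<circ> F) v" for v
      using VC.linear_eq_on[OF \<phi>(1), of "\<psi> \<circ> F" v B] spanB by blast
    then show False
      using \<phi>(2) \<psi>(2) by (metis comp_apply)
  qed
  show ?thesis
  proof (rule ex1I[of _ F])
    fix G assume G: "Vector_Spaces.linear sV sW G \<and> (\<forall>x y z. G (\<tau> x y z) = f x y z)"
    show "G = F"
    proof
      fix v
      have "\<And>p. p \<in> ?P \<Longrightarrow> G p = F p" using G Ff by auto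
      then show "G v = F v"
        using VW.linear_eq_on[of G F v ?P] G F(1) span by blast
    qed
  qed (use F Ff in auto)
qed

section \<open>Zariski topologies\<close>

text \<open>Coordinate-free: the polynomial functions are the algebra generated by the linear forms.\<close>

inductive_set poly_fun :: "(complex \<Rightarrow> 'v::ab_group_add \<Rightarrow> 'v) \<Rightarrow> ('v \<Rightarrow> complex) set"
  for s where
  linear_form: "Vector_Spaces.linear s (*) \<phi> \<Longrightarrow> \<phi> \<in> poly_fun s"
| const: "(\<lambda>_. k) \<in> poly_fun s"
| add: "p \<in> poly_fun s \<Longrightarrow> q \<in> poly_fun s \<Longrightarrow> (\<lambda>v. p v + q v) \<in> poly_fun s"
| mult: "p \<in> poly_fun s \<Longrightarrow> q \<in> poly_fun s \<Longrightarrow> (\<lambda>v. p v * q v) \<in> poly_fun s"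

definition homogeneous_poly_fun :: "(complex \<Rightarrow> 'v::ab_group_add \<Rightarrow> 'v) \<Rightarrow> ('v \<Rightarrow> complex) set" where
  "homogeneous_poly_fun s = {p \<in> poly_fun s. \<exists>d::nat. \<forall>k v. p (s k v) = k ^ d * p v}"

definition zariski_open :: "(complex \<Rightarrow> 'v::ab_group_add \<Rightarrow> 'v) \<Rightarrow> 'v set \<Rightarrow> bool" where
  "zariski_open s U \<longleftrightarrow> (\<exists>P \<subseteq> poly_fun s. U = UNIV - {v. \<forall>p\<in>P. p v = 0})"

definition zariski :: "(complex \<Rightarrow> 'v::ab_group_add \<Rightarrow> 'v) \<Rightarrow> 'v topology" where
  "zariski s = topology (zariski_open s)"

text \<open>Points of the projective space \<open>\<P>(V)\<close> are the one-dimensional subspaces of \<open>V\<close>.\<close>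

definition proj_point :: "(complex \<Rightarrow> 'v::ab_group_add \<Rightarrow> 'v) \<Rightarrow> 'v \<Rightarrow> 'v set" where
  "proj_point s v = module.span s {v}"

definition proj_space :: "(complex \<Rightarrow> 'v::ab_group_add \<Rightarrow> 'v) \<Rightarrow> 'v set set" where
  "proj_space s = {proj_point s v |v. v \<noteq> 0}"

definition proj_zariski_open :: "(complex \<Rightarrow> 'v::ab_group_add \<Rightarrow> 'v) \<Rightarrow> 'v set set \<Rightarrow> bool" where
  "proj_zariski_open s U \<longleftrightarrow> (\<exists>P \<subseteq> homogeneous_poly_fun s.
     U = proj_space s - {L \<in> proj_space s. \<forall>p\<in>P. \<forall>v\<in>L - {0}. p v = 0})"

definition proj_zariski :: "(complex \<Rightarrow> 'v::ab_group_add \<Rightarrow> 'v) \<Rightarrow> 'v set topology" where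
  "proj_zariski s = topology (proj_zariski_open s)"

lemma istopology_zariski_open: "istopology (zariski_open s)"
  unfolding istopology_def
proof (intro conjI allI impI)
  fix S T assume "zariski_open s S" "zariski_open s T"
  then obtain P Q where P: "P \<subseteq> poly_fun s" "S = UNIV - {v. \<forall>p\<in>P. p v = 0}"
    and Q: "Q \<subseteq> poly_fun s" "T = UNIV - {v. \<forall>p\<in>Q. p v = 0}"
    unfolding zariski_open_def by blast
  let ?R = "{(\<lambda>v. p v * q v) |p q. p \<in> P \<and> q \<in> Q}"
  have "?R \<subseteq> poly_fun s" using P(1) Q(1) by (auto intro: poly_fun.mult)
  moreover have "S \<inter> T = UNIV - {v. \<forall>r\<in>?R. r v = 0}" (is "_ = ?U")
  proof (intro equalityI subsetI)
    fix v assume "v \<in> S \<inter> T"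
    then obtain p q where pq: "p \<in> P" "q \<in> Q" "p v \<noteq> 0" "q v \<noteq> 0"
      unfolding P(2) Q(2) by auto
    have "(\<lambda>v. p v * q v) \<in> ?R" using pq(1,2) by blast
    moreover have "(\<lambda>v. p v * q v) v \<noteq> 0" using pq(3,4) by simp
    ultimately have "\<not> (\<forall>r\<in>?R. r v = 0)" by meson
    then show "v \<in> ?U" by simp
  next
    fix v assume "v \<in> ?U"
    then obtain r where "r \<in> ?R" and v: "r v \<noteq> 0"
      by blast
    then obtain p q where "p \<in> P" "q \<in> Q" and r: "r = (\<lambda>v. p v * q v)"
      by blast
    moreover have "p v \<noteq> 0" "q v \<noteq> 0" using v unfolding r by auto
    ultimately show "v \<in> S \<inter> T" unfolding P(2) Q(2) by blast
  qed
  ultimately show "zariski_open s (S \<inter> T)" unfolding zariski_open_def by blast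
next
  fix \<K> assume "\<forall>K\<in>\<K>. zariski_open s K"
  then have "\<forall>K\<in>\<K>. \<exists>P. P \<subseteq> poly_fun s \<and> K = UNIV - {v. \<forall>p\<in>P. p v = 0}"
    unfolding zariski_open_def by simp
  from bchoice[OF this] obtain P where
    P: "\<forall>K\<in>\<K>. P K \<subseteq> poly_fun s \<and> K = UNIV - {v. \<forall>p\<in>P K. p v = 0}"
    by blast
  have "\<Union>\<K> = (\<Union>K\<in>\<K>. UNIV - {v. \<forall>p\<in>P K. p v = 0})"
    using P SUP_cong[of \<K> \<K> "\<lambda>K. K" "\<lambda>K. UNIV - {v. \<forall>p\<in>P K. p v = 0}"]
    unfolding image_ident by blast
  also have "\<dots> = UNIV - {v. \<forall>p\<in>(\<Union>K\<in>\<K>. P K). p v = 0}" by blast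
  finally have "\<Union>\<K> = UNIV - {v. \<forall>p\<in>(\<Union>K\<in>\<K>. P K). p v = 0}" .
  then show "zariski_open s (\<Union>\<K>)"
    unfolding zariski_open_def using P by (intro exI[of _ "\<Union>K\<in>\<K>. P K"]) blast
qed

lemma openin_zariski: "openin (zariski s) = zariski_open s"
  by (simp add: zariski_def istopology_zariski_open)

lemma istopology_proj_zariski_open:
  assumes "vector_space s"
  shows "istopology (proj_zariski_open s)"
  unfolding istopology_def
proof (intro conjI allI impI)
  interpret V: vector_space s by fact
  fix S T assume "proj_zariski_open s S" "proj_zariski_open s T"
  then obtain P Q where P: "P \<subseteq> homogeneous_poly_fun s"
      "S = proj_space s - {L \<in> proj_space s. \<forall>p\<in>P. \<forall>v\<in>L - {0}. p v = 0}"
    and Q: "Q \<subseteq> homogeneous_poly_fun s"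
      "T = proj_space s - {L \<in> proj_space s. \<forall>p\<in>Q. \<forall>v\<in>L - {0}. p v = 0}"
    unfolding proj_zariski_open_def by blast
  let ?R = "{(\<lambda>v. p v * q v) |p q. p \<in> P \<and> q \<in> Q}"
  have "(\<lambda>v. p v * q v) \<in> homogeneous_poly_fun s"
    if p: "p \<in> homogeneous_poly_fun s" and q: "q \<in> homogeneous_poly_fun s" for p q
  proof -
    from p q obtain d e where "p \<in> poly_fun s" "\<And>k v. p (s k v) = k ^ d * p v"
        "q \<in> poly_fun s" "\<And>k v. q (s k v) = k ^ e * q v"
      unfolding homogeneous_poly_fun_def by blast
    then show ?thesis
      unfolding homogeneous_poly_fun_def
      by (auto intro!: poly_fun.mult exI[of _ "d + e"] simp: power_add)
  qed
  then have "?R \<subseteq> homogeneous_poly_fun s" using P(1) Q(1) by blast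
  moreover have "S \<inter> T =
      proj_space s - {L \<in> proj_space s. \<forall>p\<in>?R. \<forall>v\<in>L - {0}. p v = 0}" (is "_ = ?U")
  proof
    show "S \<inter> T \<subseteq> ?U"
    proof
      fix L assume "L \<in> S \<inter> T"
      then obtain p q v w where L: "L \<in> proj_space s" and p: "p \<in> P" "v \<in> L - {0}" "p v \<noteq> 0"
        and q: "q \<in> Q" "w \<in> L - {0}" "q w \<noteq> 0"
        unfolding P(2) Q(2) by blast
      obtain u where u: "L = V.span {u}"
        using L unfolding proj_space_def proj_point_def by blast
      obtain k l where k: "v = s k u" "k \<noteq> 0" and l: "w = s l u"
        using p(2) q(2) unfolding u V.span_singleton by auto
      have w: "w = s (l / k) v" using k l by simp
      obtain e where "q w = (l / k) ^ e * q v"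
        using q(1) Q(1) w unfolding homogeneous_poly_fun_def by blast
      then have "q v \<noteq> 0" using q(3) by auto
      then have "(\<lambda>v. p v * q v) v \<noteq> 0" using p(3) by simp
      moreover have "(\<lambda>v. p v * q v) \<in> ?R" using p(1) q(1) by blast
      ultimately have "\<not> (\<forall>r\<in>?R. \<forall>v\<in>L - {0}. r v = 0)" using p(2) by meson
      then show "L \<in> ?U" using L by simp
    qed
    show "?U \<subseteq> S \<inter> T"
    proof
      fix L assume "L \<in> ?U"
      then have L: "L \<in> proj_space s" and "\<not> (\<forall>r\<in>?R. \<forall>v\<in>L - {0}. r v = 0)"
        by simp_all
      then obtain r v where "r \<in> ?R" and v: "v \<in> L - {0}" "r v \<noteq> 0"
        by blast
      then obtain p q where "p \<in> P" "q \<in> Q" and r: "r = (\<lambda>v. p v * q v)"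
        by blast
      moreover have "p v \<noteq> 0" "q v \<noteq> 0" using v(2) unfolding r by auto
      ultimately have "\<exists>p\<in>P. \<exists>v\<in>L - {0}. p v \<noteq> 0" "\<exists>q\<in>Q. \<exists>v\<in>L - {0}. q v \<noteq> 0"
        using v(1) by blast+
      then show "L \<in> S \<inter> T" unfolding P(2) Q(2) using L by simp
    qed
  qed
  ultimately show "proj_zariski_open s (S \<inter> T)" unfolding proj_zariski_open_def by blast
next
  fix \<K> assume "\<forall>K\<in>\<K>. proj_zariski_open s K"
  then have "\<forall>K\<in>\<K>. \<exists>P. P \<subseteq> homogeneous_poly_fun s \<and>
      K = proj_space s - {L \<in> proj_space s. \<forall>p\<in>P. \<forall>v\<in>L - {0}. p v = 0}"
    unfolding proj_zariski_open_def by simp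
  from bchoice[OF this] obtain P where
    P: "\<forall>K\<in>\<K>. P K \<subseteq> homogeneous_poly_fun s \<and>
        K = proj_space s - {L \<in> proj_space s. \<forall>p\<in>P K. \<forall>v\<in>L - {0}. p v = 0}"
    by blast
  have "\<Union>\<K> = (\<Union>K\<in>\<K>. proj_space s - {L \<in> proj_space s. \<forall>p\<in>P K. \<forall>v\<in>L - {0}. p v = 0})"
    using P SUP_cong[of \<K> \<K> "\<lambda>K. K"
        "\<lambda>K. proj_space s - {L \<in> proj_space s. \<forall>p\<in>P K. \<forall>v\<in>L - {0}. p v = 0}"]
    unfolding image_ident by blast
  also have "\<dots> =
      proj_space s - {L \<in> proj_space s. \<forall>p\<in>(\<Union>K\<in>\<K>. P K). \<forall>v\<in>L - {0}. p v = 0}"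
    by blast
  finally have "\<Union>\<K> =
      proj_space s - {L \<in> proj_space s. \<forall>p\<in>(\<Union>K\<in>\<K>. P K). \<forall>v\<in>L - {0}. p v = 0}" .
  then show "proj_zariski_open s (\<Union>\<K>)"
    unfolding proj_zariski_open_def using P by (intro exI[of _ "\<Union>K\<in>\<K>. P K"]) blast
qed

lemma openin_proj_zariski:
  "vector_space s \<Longrightarrow> openin (proj_zariski s) = proj_zariski_open s"
  by (simp add: proj_zariski_def istopology_proj_zariski_open)

section \<open>Krull dimension\<close>

definition irreducible_in :: "'x topology \<Rightarrow> 'x set \<Rightarrow> bool" where
  "irreducible_in X Z \<longleftrightarrow> Z \<subseteq> topspace X \<and> Z \<noteq> {} \<and>
     (\<forall>C D. closedin X C \<and> closedin X D \<and> Z \<subseteq> C \<union> D \<longrightarrow> Z \<subseteq> C \<or> Z \<subseteq> D)"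

text \<open>The supremum is taken in \<open>ereal\<close>, so that the empty space has dimension \<open>-\<infinity>\<close>.\<close>

definition krull_dim :: "'x topology \<Rightarrow> ereal" where
  "krull_dim X = Sup {ereal (real d) |d. \<exists>Z :: nat \<Rightarrow> 'x set.
     (\<forall>i\<le>d. closedin X (Z i) \<and> irreducible_in X (Z i)) \<and> (\<forall>i<d. Z i \<subset> Z (Suc i))}"

section \<open>Border subrank\<close>

definition general_linear :: "(complex \<Rightarrow> 'a::ab_group_add \<Rightarrow> 'a) \<Rightarrow> ('a \<Rightarrow> 'a) set" where
  "general_linear s = {f. Vector_Spaces.linear s s f \<and> bij f}"

text \<open>
  The map \<open>f \<otimes> g \<otimes> h\<close> on the tensor product; existence and uniqueness follow from
  \<open>tensor_product_universal\<close>.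
\<close>

definition tensor_map ::
  "(complex \<Rightarrow> 'v::ab_group_add \<Rightarrow> 'v) \<Rightarrow> ('a \<Rightarrow> 'b \<Rightarrow> 'c \<Rightarrow> 'v) \<Rightarrow>
   ('a \<Rightarrow> 'a) \<Rightarrow> ('b \<Rightarrow> 'b) \<Rightarrow> ('c \<Rightarrow> 'c) \<Rightarrow> 'v \<Rightarrow> 'v" where
  "tensor_map sV \<tau> f g h =
     (THE F. Vector_Spaces.linear sV sV F \<and> (\<forall>x y z. F (\<tau> x y z) = \<tau> (f x) (g y) (h z)))"

definition GL_orbit ::
  "(complex \<Rightarrow> 'a::ab_group_add \<Rightarrow> 'a) \<Rightarrow> (complex \<Rightarrow> 'b::ab_group_add \<Rightarrow> 'b) \<Rightarrow>
   (complex \<Rightarrow> 'c::ab_group_add \<Rightarrow> 'c) \<Rightarrow> (complex \<Rightarrow> 'v::ab_group_add \<Rightarrow> 'v) \<Rightarrow>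
   ('a \<Rightarrow> 'b \<Rightarrow> 'c \<Rightarrow> 'v) \<Rightarrow> 'v \<Rightarrow> 'v set" where
  "GL_orbit sA sB sC sV \<tau> T = {tensor_map sV \<tau> f g h T |f g h.
     f \<in> general_linear sA \<and> g \<in> general_linear sB \<and> h \<in> general_linear sC}"

definition unit_tensor ::
  "('a \<Rightarrow> 'b \<Rightarrow> 'c \<Rightarrow> 'v::ab_group_add) \<Rightarrow> (nat \<Rightarrow> 'a) \<Rightarrow> (nat \<Rightarrow> 'b) \<Rightarrow> (nat \<Rightarrow> 'c) \<Rightarrow>
   nat \<Rightarrow> 'v" where
  "unit_tensor \<tau> a b c r = (\<Sum>i=1..r. \<tau> (a i) (b i) (c i))"

text \<open>
  The orbit closure is the Zariski closure, which for orbits of an algebraic group is also the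
  Euclidean closure.
  \<open>Sup\<close> is the maximum of a finite nonempty set of naturals; the set is empty only for \<open>T = 0\<close>,
  which then gets the value \<open>0\<close>.
\<close>

definition border_subrank ::
  "(complex \<Rightarrow> 'a::ab_group_add \<Rightarrow> 'a) \<Rightarrow> (complex \<Rightarrow> 'b::ab_group_add \<Rightarrow> 'b) \<Rightarrow>
   (complex \<Rightarrow> 'c::ab_group_add \<Rightarrow> 'c) \<Rightarrow> (complex \<Rightarrow> 'v::ab_group_add \<Rightarrow> 'v) \<Rightarrow>
   ('a \<Rightarrow> 'b \<Rightarrow> 'c \<Rightarrow> 'v) \<Rightarrow> nat \<Rightarrow> (nat \<Rightarrow> 'a) \<Rightarrow> (nat \<Rightarrow> 'b) \<Rightarrow> (nat \<Rightarrow> 'c) \<Rightarrow> 'v \<Rightarrow> nat" where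
  "border_subrank sA sB sC sV \<tau> n a b c T =
     Sup {r. 1 \<le> r \<and> r \<le> n \<and> unit_tensor \<tau> a b c r \<in> zariski sV closure_of GL_orbit sA sB sC sV \<tau> T}"

definition Q_max ::
  "(complex \<Rightarrow> 'a::ab_group_add \<Rightarrow> 'a) \<Rightarrow> (complex \<Rightarrow> 'b::ab_group_add \<Rightarrow> 'b) \<Rightarrow>
   (complex \<Rightarrow> 'c::ab_group_add \<Rightarrow> 'c) \<Rightarrow> (complex \<Rightarrow> 'v::ab_group_add \<Rightarrow> 'v) \<Rightarrow>
   ('a \<Rightarrow> 'b \<Rightarrow> 'c \<Rightarrow> 'v) \<Rightarrow> nat \<Rightarrow> (nat \<Rightarrow> 'a) \<Rightarrow> (nat \<Rightarrow> 'b) \<Rightarrow> (nat \<Rightarrow> 'c) \<Rightarrow> 'v set set" where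
  "Q_max sA sB sC sV \<tau> n a b c = proj_zariski sV closure_of
     {proj_point sV T |T. T \<noteq> 0 \<and> border_subrank sA sB sC sV \<tau> n a b c T = n}"

end

theory Submission
  imports Defs "HOL-Library.Function_Algebras"
begin

text \<open>
  Let \<open>W\<close> be spanned by the \<open>a i \<otimes> b j \<otimes> c k\<close> with \<open>k < max i j\<close> or \<open>i = j = k\<close>.  The one-parameter
  subgroup with weights \<open>2^i\<close>, \<open>2^j\<close>, \<open>-2 * 2^k\<close> has positive weight on the former and weight \<open>0\<close> on
  the latter tensors, so every element of \<open>W\<close> with nonzero diagonal degenerates to the unit tensor.
  \<open>W\<close> is stable under three Borel subgroups, and moving it by the opposite unipotent groups gives
  a polynomial family whose differential at the unit tensor is injective; its number of parameters
  is the claimed bound.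

  Krull dimension is bounded below by the chain of closures of the subfamilies in which more and
  more parameters are switched on.  These are irreducible because polynomial functions restrict to
  polynomials on lines.  They are distinct because counting monomials yields a homogeneous
  relation between \<open>d + 1\<close> coordinates on a \<open>d\<close>-parameter subfamily, whose lowest-degree part at
  the origin would have to vanish on the next subfamily, where these coordinates are independent to
  first order.
\<close>

section \<open>Polynomials in finitely many variables\<close>

definition fscale :: "complex \<Rightarrow> ('x \<Rightarrow> complex) \<Rightarrow> 'x \<Rightarrow> complex" where
  "fscale c f = (\<lambda>x. c * f x)"

interpretation fn: vector_space fscale
  by unfold_locales (auto simp: fscale_def fun_eq_iff algebra_simps)

lemma sum_fun_apply: "(\<Sum>i\<in>A. f i) x = (\<Sum>i\<in>A. f i x)" for f :: "'a \<Rightarrow> 'b \<Rightarrow> complex"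
  by (induction A rule: infinite_finite_induct) auto

definition monomial :: "'i set \<Rightarrow> ('i \<Rightarrow> nat) \<Rightarrow> ('i \<Rightarrow> complex) \<Rightarrow> complex" where
  "monomial J \<beta> x = (\<Prod>i\<in>J. x i ^ \<beta> i)"

text \<open>The bound \<open>K\<close> is on each exponent separately, not on the total degree: for
  finite \<open>J\<close> at most \<open>(K + 1) ^ card J\<close> monomials span, and bounds add
  under products.\<close>

definition polys :: "'i set \<Rightarrow> nat \<Rightarrow> (('i \<Rightarrow> complex) \<Rightarrow> complex) set" where
  "polys J K = fn.span (monomial J ` (J \<rightarrow>\<^sub>E {..K}))"

lemma polys_induct [consumes 1, case_names zero step]:
  assumes "f \<in> polys J K" "P (\<lambda>_. 0)"
    and "\<And>k \<beta> g. \<beta> \<in> J \<rightarrow>\<^sub>E {..K} \<Longrightarrow> g \<in> polys J K \<Longrightarrow> P g \<Longrightarrow> P (\<lambda>x. k * monomial J \<beta> x + g x)"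
  shows "P f"
proof -
  have "f \<in> polys J K \<and> P f"
    using assms(1) unfolding polys_def
  proof (induction rule: fn.span_induct_alt)
    case base
    show ?case using assms(2) fn.span_zero by (auto simp: zero_fun_def)
  next
    case (step c m g)
    then obtain \<beta> where \<beta>: "\<beta> \<in> J \<rightarrow>\<^sub>E {..K}" "m = monomial J \<beta>" by blast
    have "fscale c m + g \<in> fn.span (monomial J ` (J \<rightarrow>\<^sub>E {..K}))"
      using step by (intro fn.span_add fn.span_scale) (auto intro: fn.span_base)
    moreover have "P (\<lambda>x. c * monomial J \<beta> x + g x)"
      using assms(3)[OF \<beta>(1)] step unfolding polys_def by blast
    moreover have "fscale c m + g = (\<lambda>x. c * monomial J \<beta> x + g x)"
      by (simp add: \<beta> plus_fun_def fscale_def)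
    ultimately show ?case by simp
  qed
  then show ?thesis ..
qed

lemma polys_add: "f \<in> polys J K \<Longrightarrow> g \<in> polys J K \<Longrightarrow> (\<lambda>x. f x + g x) \<in> polys J K"
  using fn.span_add[of f _ g] by (simp add: polys_def plus_fun_def)

lemma polys_scale: "f \<in> polys J K \<Longrightarrow> (\<lambda>x. k * f x) \<in> polys J K"
  using fn.span_scale[of f _ k] by (simp add: polys_def fscale_def)

lemma polys_zero: "(\<lambda>_. 0) \<in> polys J K"
  using fn.span_zero by (simp add: polys_def zero_fun_def)

lemma polys_sum: "(\<And>a. a \<in> A \<Longrightarrow> f a \<in> polys J K) \<Longrightarrow> (\<lambda>x. \<Sum>a\<in>A. f a x) \<in> polys J K"
  by (induction A rule: infinite_finite_induct) (auto intro: polys_zero polys_add)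

lemma monomial_in_polys: "(\<And>i. i \<in> J \<Longrightarrow> \<beta> i \<le> K) \<Longrightarrow> monomial J \<beta> \<in> polys J K"
  unfolding polys_def
proof (rule fn.span_base)
  assume "\<And>i. i \<in> J \<Longrightarrow> \<beta> i \<le> K"
  then have "restrict \<beta> J \<in> J \<rightarrow>\<^sub>E {..K}" by auto
  moreover have "monomial J \<beta> = monomial J (restrict \<beta> J)"
    by (auto simp: monomial_def fun_eq_iff)
  ultimately show "monomial J \<beta> \<in> monomial J ` (J \<rightarrow>\<^sub>E {..K})" by blast
qed

lemma polys_const: "(\<lambda>_. k) \<in> polys J K"
  using polys_scale[OF monomial_in_polys[of J "\<lambda>_. 0" K], of k] by (simp add: monomial_def)

lemma polys_var:
  assumes "finite J" "i \<in> J"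
  shows "(\<lambda>x. x i) \<in> polys J 1"
proof -
  have "monomial J (\<lambda>l. if l = i then 1 else 0) x = x i" for x
  proof -
    have "monomial J (\<lambda>l. if l = i then 1 else 0) x = (\<Prod>l\<in>J. if l = i then x i else 1)"
      unfolding monomial_def by (intro prod.cong) auto
    then show ?thesis using assms by simp
  qed
  then have "monomial J (\<lambda>l. if l = i then 1 else 0) = (\<lambda>x. x i)" ..
  then show ?thesis
    using monomial_in_polys[of J "\<lambda>l. if l = i then 1 else 0" 1] by simp
qed

lemma polys_mono: "K \<le> K' \<Longrightarrow> f \<in> polys J K \<Longrightarrow> f \<in> polys J K'"
  unfolding polys_def by (rule subsetD[OF fn.span_mono]) (auto intro!: image_mono PiE_mono)

lemma polys_mult:
  assumes f: "f \<in> polys J K" and g: "g \<in> polys J L"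
  shows "(\<lambda>x. f x * g x) \<in> polys J (K + L)"
  using f
proof (induction rule: polys_induct)
  case zero
  show ?case by (simp add: polys_zero)
next
  case (step k \<beta> f)
  have "(\<lambda>x. monomial J \<beta> x * g x) \<in> polys J (K + L)"
    using g
  proof (induction rule: polys_induct)
    case zero
    show ?case by (simp add: polys_zero)
  next
    case (step k' \<gamma> g)
    have "monomial J (\<lambda>i. \<beta> i + \<gamma> i) \<in> polys J (K + L)"
      using \<open>\<beta> \<in> _\<close> step(1) by (intro monomial_in_polys add_mono) (auto simp: PiE_iff)
    from polys_add[OF polys_scale[OF this, of k'] step(3)] show ?case
      by (simp add: monomial_def power_add prod.distrib algebra_simps)
  qed
  from polys_add[OF polys_scale[OF this, of k] step(3)] show ?case
    by (simp add: algebra_simps)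
qed

lemma polys_power: "f \<in> polys J K \<Longrightarrow> (\<lambda>x. f x ^ m) \<in> polys J (K * m)"
proof (induction m)
  case (Suc m)
  then show ?case using polys_mult[of f J K "\<lambda>x. f x ^ m"] by simp
qed (simp add: polys_const)

lemma polys_prod:
  "(\<And>a. a \<in> A \<Longrightarrow> f a \<in> polys J (K a)) \<Longrightarrow> (\<lambda>x. \<Prod>a\<in>A. f a x) \<in> polys J (\<Sum>a\<in>A. K a)"
proof (induction A rule: infinite_finite_induct)
  case (insert a A)
  then show ?case using polys_mult[of "f a" J "K a" "\<lambda>x. \<Prod>a\<in>A. f a x"] by simp
qed (simp_all add: polys_const)

text \<open>Zeroing variables instead of removing them keeps all subfamilies restrictions of one map
  on one type.\<close>

definition restr :: "'i set \<Rightarrow> ('i \<Rightarrow> complex) \<Rightarrow> 'i \<Rightarrow> complex" where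
  "restr J x = (\<lambda>i. if i \<in> J then x i else 0)"

lemma polys_restr:
  assumes "finite I" "J \<subseteq> I" "f \<in> polys I K"
  shows "(\<lambda>x. f (restr J x)) \<in> polys J K"
  using assms(3)
proof (induction rule: polys_induct)
  case zero
  show ?case by (simp add: polys_zero)
next
  case (step k \<beta> g)
  \<comment> \<open>With \<open>0 ^ 0 = 1\<close>, the product over \<open>I - J\<close> is 1 if the
    monomial avoids the variables outside \<open>J\<close>, and 0 otherwise.\<close>
  have "monomial I \<beta> (restr J x) = (\<Prod>i\<in>I-J. 0 ^ \<beta> i) * monomial J \<beta> x" for x
    unfolding monomial_def restr_def using prod.subset_diff[OF assms(2,1), of "\<lambda>i. (if i \<in> J then x i else 0) ^ \<beta> i"]
    by simp
  moreover have "monomial J \<beta> \<in> polys J K"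
    using step(1) assms(2) by (intro monomial_in_polys) (auto simp: PiE_iff)
  ultimately show ?case
    using step(3) by (auto intro!: polys_add polys_scale)
qed

section \<open>Restriction to lines\<close>

lemma polys_on_line:
  assumes "f \<in> polys J K"
  shows "\<exists>p. \<forall>t. f (\<lambda>i. x i + t * v i) = poly p t"
  using assms
proof (induction rule: polys_induct)
  case zero
  show ?case by (intro exI[of _ 0]) simp
next
  case (step k \<beta> g)
  then obtain p where "\<forall>t. g (\<lambda>i. x i + t * v i) = poly p t" by blast
  then show ?case
    by (intro exI[of _ "smult k (\<Prod>i\<in>J. [:x i, v i:] ^ \<beta> i) + p"])
       (simp add: monomial_def poly_prod)
qed

text \<open>Irreducibility of affine space: on the line through \<open>x\<close> and
  \<open>y\<close> both functions become univariate polynomials, nonzero at 0 and at 1 respectively,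
  so their product has only finitely many roots.\<close>

lemma polys_common_nonzero:
  assumes f: "f \<in> polys J K" "f x \<noteq> 0" and g: "g \<in> polys J L" "g y \<noteq> 0"
  shows "\<exists>z. f z \<noteq> 0 \<and> g z \<noteq> 0"
proof -
  obtain p where p: "\<And>t. f (\<lambda>i. x i + t * (y i - x i)) = poly p t"
    using polys_on_line[OF f(1), of x "\<lambda>i. y i - x i"] by blast
  obtain q where q: "\<And>t. g (\<lambda>i. x i + t * (y i - x i)) = poly q t"
    using polys_on_line[OF g(1), of x "\<lambda>i. y i - x i"] by blast
  have "poly p 0 \<noteq> 0" "poly q 1 \<noteq> 0"
    using f(2) g(2) by (simp_all flip: p q)
  then have "p * q \<noteq> 0" by auto
  then have "finite {t. poly (p * q) t = 0}" by (rule poly_roots_finite)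
  then obtain t where "poly (p * q) t \<noteq> 0"
    using infinite_UNIV_char_0[where 'a=complex] by (metis (mono_tags, lifting) UNIV_I mem_Collect_eq finite_subset subsetI)
  then show ?thesis using p q by (metis mult_eq_0_iff poly_mult)
qed

section \<open>Algebraic relations from counting monomials\<close>

lemma fn_relation:
  fixes f :: "'a \<Rightarrow> 'x \<Rightarrow> complex"
  assumes "finite A" "finite B" "card B < card A" "f ` A \<subseteq> fn.span B"
  shows "\<exists>k. (\<exists>a\<in>A. k a \<noteq> 0) \<and> (\<forall>x. (\<Sum>a\<in>A. k a * f a x) = 0)"
proof (cases "inj_on f A")
  case True
  have "fn.dependent (f ` A)"
    using fn.independent_span_bound[OF assms(2) _ assms(4)] assms(3) card_image[OF True] by auto
  then obtain u where u: "\<exists>v\<in>f ` A. u v \<noteq> 0" "(\<Sum>v\<in>f ` A. fscale (u v) v) = 0"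
    using fn.dependent_finite[of "f ` A"] assms(1) by auto
  from u(2) have "(\<Sum>a\<in>A. fscale (u (f a)) (f a)) = 0"
    by (simp add: sum.reindex[OF True])
  then have "(\<Sum>a\<in>A. u (f a) * f a x) = 0" for x
    by (drule_tac fun_cong[of _ _ x]) (simp add: sum_fun_apply fscale_def)
  then show ?thesis using u(1) by (intro exI[of _ "u \<circ> f"]) auto
next
  case False
  then obtain a b where ab: "a \<in> A" "b \<in> A" "a \<noteq> b" "f a = f b" by (auto simp: inj_on_def)
  let ?k = "\<lambda>c. if c = a then 1 else if c = b then - 1 else (0::complex)"
  have "(\<Sum>c\<in>A. ?k c * f c x) = (\<Sum>c\<in>{a,b}. ?k c * f c x)" for x
    using ab assms(1) by (intro sum.mono_neutral_right) auto
  then show ?thesis using ab by (intro exI[of _ ?k]) auto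
qed

text \<open>In \<open>E\<close> the left side grows with degree \<open>d\<close>, the right side
  with degree \<open>d + 1\<close>. The witness absorbs the factor \<open>(c + 1) ^ d\<close> that
  arises when the constant is pulled out of the base.\<close>

lemma ex_power_less: "\<exists>E::nat. (c * E + 1) ^ d < (E + 1) ^ Suc d"
proof
  let ?E = "(c + 1) ^ d"
  have "(c * ?E + 1) ^ d \<le> ((c + 1) * (?E + 1)) ^ d"
    by (intro power_mono) (auto simp: algebra_simps)
  also have "\<dots> = (c + 1) ^ d * (?E + 1) ^ d" by (rule power_mult_distrib)
  also have "\<dots> < (?E + 1) * (?E + 1) ^ d" by (intro mult_strict_right_mono) auto
  finally show "(c * ?E + 1) ^ d < (?E + 1) ^ Suc d" by simp
qed

text \<open>Padding with powers of \<open>r\<close> gives every product exactly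
  \<open>E * card L\<close> factors, each with exponents at most \<open>K\<close>, so one bound
  serves all \<alpha>.\<close>

lemma monomial_homogenised_in_polys:
  assumes "finite L" "\<And>l. l \<in> L \<Longrightarrow> y l \<in> polys J K" "r \<in> polys J K" "\<alpha> \<in> L \<rightarrow>\<^sub>E {..E}"
  shows "(\<lambda>x. monomial L \<alpha> (\<lambda>l. y l x) * r x ^ (E * card L - (\<Sum>l\<in>L. \<alpha> l))) \<in> polys J (K * card L * E)"
proof -
  have le: "(\<Sum>l\<in>L. \<alpha> l) \<le> E * card L"
    using sum_bounded_above[of L \<alpha> E] assms(4) by (auto simp: mult.commute PiE_iff)
  have "(\<lambda>x. \<Prod>l\<in>L. y l x ^ \<alpha> l) \<in> polys J (\<Sum>l\<in>L. K * \<alpha> l)"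
    using assms(2) by (intro polys_prod polys_power)
  from polys_mult[OF this polys_power[OF assms(3), of "E * card L - (\<Sum>l\<in>L. \<alpha> l)"]]
  have "(\<lambda>x. monomial L \<alpha> (\<lambda>l. y l x) * r x ^ (E * card L - (\<Sum>l\<in>L. \<alpha> l)))
      \<in> polys J (K * (\<Sum>l\<in>L. \<alpha> l) + K * (E * card L - (\<Sum>l\<in>L. \<alpha> l)))"
    by (simp add: monomial_def sum_distrib_left)
  also have "K * (\<Sum>l\<in>L. \<alpha> l) + K * (E * card L - (\<Sum>l\<in>L. \<alpha> l)) = K * card L * E"
    using le by (simp flip: distrib_left)
  finally show ?thesis .
qed

text \<open>
  For large \<open>E\<close> the monomials in the \<open>y l\<close> with exponents up to \<open>E\<close> outnumber the monomials in fewer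
  variables that span them.  The powers of \<open>r\<close> make the relation homogeneous.
\<close>

lemma homogeneous_relation:
  assumes "finite J" "finite L" "card J < card L"
    and "\<forall>l\<in>L. y l \<in> polys J K" "r \<in> polys J K"
  shows "\<exists>E k. (\<exists>\<alpha>\<in>L \<rightarrow>\<^sub>E {..E}. k \<alpha> \<noteq> (0::complex)) \<and>
    (\<forall>x. (\<Sum>\<alpha>\<in>L \<rightarrow>\<^sub>E {..E}. k \<alpha> * (monomial L \<alpha> (\<lambda>l. y l x) * r x ^ (E * card L - (\<Sum>l\<in>L. \<alpha> l)))) = 0)"
proof -
  obtain E where E: "(K * card L * E + 1) ^ card J < (E + 1) ^ Suc (card J)"
    using ex_power_less by blast
  let ?B = "monomial J ` (J \<rightarrow>\<^sub>E {..K * card L * E})"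
  have "finite ?B" using assms(1) by (intro finite_imageI finite_PiE) auto
  have "card ?B \<le> card (J \<rightarrow>\<^sub>E {..K * card L * E})"
    using assms(1) by (intro card_image_le finite_PiE) auto
  also have "\<dots> = (K * card L * E + 1) ^ card J" using assms(1) by (simp add: card_funcsetE)
  also note E
  also have "(E + 1) ^ Suc (card J) \<le> (E + 1) ^ card L" using assms(3) by (intro power_increasing) auto
  also have "\<dots> = card (L \<rightarrow>\<^sub>E {..E})" using assms(2) by (simp add: card_funcsetE)
  finally have card: "card ?B < card (L \<rightarrow>\<^sub>E {..E})" .
  have fin: "finite (L \<rightarrow>\<^sub>E {..E})" using assms(2) by (intro finite_PiE) auto
  let ?f = "\<lambda>\<alpha> x. monomial L \<alpha> (\<lambda>l. y l x) * r x ^ (E * card L - (\<Sum>l\<in>L. \<alpha> l))"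
  have "?f ` (L \<rightarrow>\<^sub>E {..E}) \<subseteq> fn.span ?B"
    using monomial_homogenised_in_polys[OF assms(2) bspec[OF assms(4)] assms(5)] unfolding polys_def by (rule image_subsetI)
  from fn_relation[OF fin \<open>finite ?B\<close> card this] show ?thesis by (rule exI)
qed

text \<open>Induction on the variables: collecting powers of the value \<open>z\<close> of the new
  variable gives a univariate polynomial that vanishes identically. Its coefficients are sums over
  the remaining variables, to which the induction hypothesis applies.\<close>

lemma monomials_independent:
  assumes "finite L" "\<And>v. (\<Sum>\<alpha>\<in>L \<rightarrow>\<^sub>E {..E}. k \<alpha> * monomial L \<alpha> v) = 0" "\<alpha> \<in> L \<rightarrow>\<^sub>E {..E}"
  shows "k \<alpha> = (0::complex)"
  using assms
proof (induction L arbitrary: k \<alpha> rule: finite_induct)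
  case empty
  then show ?case by (simp add: monomial_def)
next
  case (insert l L)
  let ?P = "L \<rightarrow>\<^sub>E {..E}"
  have fin: "finite ?P" using insert by (intro finite_PiE) auto
  have "(\<Sum>m\<le>E. (\<Sum>\<beta>\<in>?P. k (\<beta>(l := m)) * monomial L \<beta> v) * z ^ m) = 0" for v z
  proof -
    have "0 = (\<Sum>\<alpha>\<in>insert l L \<rightarrow>\<^sub>E {..E}. k \<alpha> * monomial (insert l L) \<alpha> (v(l := z)))"
      using insert.prems(1) by simp
    also have "\<dots> = (\<Sum>(m, \<beta>)\<in>{..E} \<times> ?P. k (\<beta>(l := m)) * monomial (insert l L) (\<beta>(l := m)) (v(l := z)))"
      unfolding PiE_insert_eq using insert.hyps
      by (subst sum.reindex[OF inj_combinator]) (auto simp: o_def case_prod_unfold)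
    also have "\<dots> = (\<Sum>(m, \<beta>)\<in>{..E} \<times> ?P. k (\<beta>(l := m)) * monomial L \<beta> v * z ^ m)"
    proof (intro sum.cong refl, clarify)
      fix m \<beta>
      have "(\<Prod>i\<in>L. (v(l := z)) i ^ (\<beta>(l := m)) i) = monomial L \<beta> v"
        unfolding monomial_def using insert.hyps by (intro prod.cong) auto
      then show "k (\<beta>(l := m)) * monomial (insert l L) (\<beta>(l := m)) (v(l := z)) =
          k (\<beta>(l := m)) * monomial L \<beta> v * z ^ m"
        using insert.hyps by (simp add: monomial_def)
    qed
    also have "\<dots> = (\<Sum>m\<le>E. (\<Sum>\<beta>\<in>?P. k (\<beta>(l := m)) * monomial L \<beta> v) * z ^ m)"
      using fin by (simp add: sum.cartesian_product sum_distrib_right)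
    finally show ?thesis by simp
  qed
  then have zero: "(\<Sum>\<beta>\<in>?P. k (\<beta>(l := m)) * monomial L \<beta> v) = 0" if "m \<le> E" for m v
    using that zero_polynom_imp_zero_coeffs[of "\<lambda>m. \<Sum>\<beta>\<in>?P. k (\<beta>(l := m)) * monomial L \<beta> v" E] by blast
  obtain m \<beta> where "m \<le> E" "\<beta> \<in> ?P" "\<alpha> = \<beta>(l := m)"
    using insert.prems(2) unfolding PiE_insert_eq by auto
  then show ?case using insert.IH[OF zero] by blast
qed

text \<open>The witness is a direction \<open>v\<close> at which the lowest-degree part of the relation is nonzero:
  along a curve \<open>t \<mapsto> y\<close> with \<open>y = t v + o(t)\<close> that part dominates.\<close>

lemma relation_nonzero_along_curve:
  fixes k :: "('i \<Rightarrow> nat) \<Rightarrow> complex"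
  assumes "finite L" "\<alpha> \<in> L \<rightarrow>\<^sub>E {..E}" "k \<alpha> \<noteq> 0"
  shows "\<exists>v. \<forall>y r. (\<forall>l\<in>L. ((\<lambda>t. y t l / t) \<longlongrightarrow> v l) (at 0)) \<longrightarrow> (r \<longlongrightarrow> 1) (at 0) \<longrightarrow>
    eventually (\<lambda>t::complex. (\<Sum>\<alpha>\<in>L \<rightarrow>\<^sub>E {..E}. k \<alpha> * (monomial L \<alpha> (y t) * r t ^ (M - (\<Sum>l\<in>L. \<alpha> l)))) \<noteq> 0) (at 0)"
proof -
  define deg where "deg \<alpha> = (\<Sum>l\<in>L. \<alpha> l)" for \<alpha> :: "'i \<Rightarrow> nat"
  let ?A = "L \<rightarrow>\<^sub>E {..E}"
  define m where "m = (LEAST m. \<exists>\<alpha>\<in>?A. k \<alpha> \<noteq> 0 \<and> deg \<alpha> = m)"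
  have "\<exists>m. \<exists>\<alpha>\<in>?A. k \<alpha> \<noteq> 0 \<and> deg \<alpha> = m" using assms by blast
  from LeastI_ex[OF this] obtain \<alpha>0 where \<alpha>0: "\<alpha>0 \<in> ?A" "k \<alpha>0 \<noteq> 0" "deg \<alpha>0 = m"
    unfolding m_def by blast
  have min: "m \<le> deg \<alpha>" if "\<alpha> \<in> ?A" "k \<alpha> \<noteq> 0" for \<alpha>
    unfolding m_def using that by (intro Least_le) blast
  define k' where "k' \<alpha> = (if deg \<alpha> = m then k \<alpha> else 0)" for \<alpha>
  obtain v where v: "(\<Sum>\<alpha>\<in>?A. k' \<alpha> * monomial L \<alpha> v) \<noteq> 0"
    using monomials_independent[OF assms(1) _ \<alpha>0(1), of k'] \<alpha>0(2,3) by (auto simp: k'_def)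
  show ?thesis
  proof (intro exI[of _ v] allI impI)
    fix y :: "complex \<Rightarrow> 'i \<Rightarrow> complex" and r :: "complex \<Rightarrow> complex"
    assume y: "\<forall>l\<in>L. ((\<lambda>t. y t l / t) \<longlongrightarrow> v l) (at 0)" and r: "(r \<longlongrightarrow> 1) (at 0)"
    \<comment> \<open>The relation divided by \<open>t ^ m\<close>. The subtraction
      \<open>deg \<alpha> - m\<close> truncates only where \<open>k \<alpha> = 0\<close>; since
      \<open>0 ^ 0 = 1\<close>, the limit at 0 is the lowest-degree part at
      \<open>v\<close>.\<close>
    let ?G = "\<lambda>t. \<Sum>\<alpha>\<in>?A. k \<alpha> * (monomial L \<alpha> (\<lambda>l. y t l / t) * t ^ (deg \<alpha> - m) * r t ^ (M - deg \<alpha>))"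
    have lim: "(?G \<longlongrightarrow> (\<Sum>\<alpha>\<in>?A. k \<alpha> * (monomial L \<alpha> v * 0 ^ (deg \<alpha> - m) * 1 ^ (M - deg \<alpha>)))) (at 0)"
      unfolding monomial_def using y r by (intro tendsto_intros) auto
    have "k \<alpha> * (monomial L \<alpha> v * 0 ^ (deg \<alpha> - m) * 1 ^ (M - deg \<alpha>)) = k' \<alpha> * monomial L \<alpha> v"
      if "\<alpha> \<in> ?A" for \<alpha>
      using min[OF that] by (cases "deg \<alpha> = m"; cases "k \<alpha> = 0") (auto simp: k'_def)
    then have "(\<Sum>\<alpha>\<in>?A. k \<alpha> * (monomial L \<alpha> v * 0 ^ (deg \<alpha> - m) * 1 ^ (M - deg \<alpha>))) \<noteq> 0"
      using v by (subst sum.cong[OF refl])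
    with lim have "eventually (\<lambda>t. ?G t \<noteq> 0) (at 0)" by (rule tendsto_imp_eventually_ne)
    moreover have "eventually (\<lambda>t. t \<noteq> (0::complex)) (at 0)" by (simp add: eventually_at_filter)
    ultimately show "eventually (\<lambda>t. (\<Sum>\<alpha>\<in>?A. k \<alpha> * (monomial L \<alpha> (y t) * r t ^ (M - (\<Sum>l\<in>L. \<alpha> l)))) \<noteq> 0) (at 0)"
    proof eventually_elim
      case (elim t)
      have "t ^ m * (monomial L \<alpha> (\<lambda>l. y t l / t) * t ^ (deg \<alpha> - m)) = monomial L \<alpha> (y t)"
        if "\<alpha> \<in> ?A" "k \<alpha> \<noteq> 0" for \<alpha>
      proof -
        have "t ^ m * t ^ (deg \<alpha> - m) = (\<Prod>l\<in>L. t ^ \<alpha> l)"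
          using min[OF that] by (simp add: deg_def flip: power_add power_sum)
        moreover have "monomial L \<alpha> (y t) = monomial L \<alpha> (\<lambda>l. y t l / t) * (\<Prod>l\<in>L. t ^ \<alpha> l)"
          unfolding monomial_def prod.distrib[symmetric] power_mult_distrib[symmetric]
          using elim(2) by simp
        ultimately show ?thesis by (simp add: mult_ac)
      qed
      then have "t ^ m * (k \<alpha> * (monomial L \<alpha> (\<lambda>l. y t l / t) * t ^ (deg \<alpha> - m) * r t ^ (M - deg \<alpha>)))
          = k \<alpha> * (monomial L \<alpha> (y t) * r t ^ (M - (\<Sum>l\<in>L. \<alpha> l)))" if "\<alpha> \<in> ?A" for \<alpha>
        unfolding deg_def[symmetric] using that by (cases "k \<alpha> = 0") (simp_all add: mult_ac)
      then have "(\<Sum>\<alpha>\<in>?A. k \<alpha> * (monomial L \<alpha> (y t) * r t ^ (M - (\<Sum>l\<in>L. \<alpha> l)))) = t ^ m * ?G t"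
        unfolding sum_distrib_left by (intro sum.cong) (simp_all only:)
      then show ?case using elim by simp
    qed
  qed
qed

section \<open>Krull dimension of a projective polynomial family\<close>

lemma linear_map_0: "Vector_Spaces.linear s t f \<Longrightarrow> f 0 = 0"
  using Vector_Spaces.linear_iff[of s t f] by (metis add_cancel_right_right)

lemma linear_map_scale: "Vector_Spaces.linear s t f \<Longrightarrow> f (s k v) = t k (f v)"
  by (simp add: Vector_Spaces.linear_iff)

lemma linear_map_sum: "Vector_Spaces.linear s t f \<Longrightarrow> f (\<Sum>i\<in>A. g i) = (\<Sum>i\<in>A. f (g i))"
  using linear_map_0[of s t f]
  by (induction A rule: infinite_finite_induct) (simp_all add: Vector_Spaces.linear_iff)

lemma poly_fun_sum: "(\<And>a. a \<in> A \<Longrightarrow> f a \<in> poly_fun s) \<Longrightarrow> (\<lambda>v. \<Sum>a\<in>A. f a v) \<in> poly_fun s"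
proof (induction A rule: infinite_finite_induct)
  case (insert a A)
  then show ?case using poly_fun.add[of "f a" s "\<lambda>v. \<Sum>a\<in>A. f a v"] by simp
qed (simp_all add: poly_fun.const)

lemma poly_fun_prod: "(\<And>a. a \<in> A \<Longrightarrow> f a \<in> poly_fun s) \<Longrightarrow> (\<lambda>v. \<Prod>a\<in>A. f a v) \<in> poly_fun s"
proof (induction A rule: infinite_finite_induct)
  case (insert a A)
  then show ?case using poly_fun.mult[of "f a" s "\<lambda>v. \<Prod>a\<in>A. f a v"] by simp
qed (simp_all add: poly_fun.const)

lemma poly_fun_power: "f \<in> poly_fun s \<Longrightarrow> (\<lambda>v. f v ^ m) \<in> poly_fun s"
  using poly_fun_prod[of "{..<m}" "\<lambda>_. f" s] by simp

text \<open>Linear forms pull back with one common bound \<open>K\<close>; sums take the maximum of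
  two bounds and products add them, so the resulting \<open>L\<close> depends on
  \<open>p\<close>.\<close>

lemma poly_fun_compose_polys:
  assumes "p \<in> poly_fun s" "\<And>\<psi>. Vector_Spaces.linear s (*) \<psi> \<Longrightarrow> (\<lambda>x. \<psi> (\<phi> x)) \<in> polys I K"
  shows "\<exists>L. (\<lambda>x. p (\<phi> x)) \<in> polys I L"
  using assms(1)
proof (induction rule: poly_fun.induct)
  case (linear_form \<psi>)
  then show ?case using assms(2) by blast
next
  case (const k)
  then show ?case using polys_const by blast
next
  case (add p q)
  then obtain L M where "(\<lambda>x. p (\<phi> x)) \<in> polys I L" "(\<lambda>x. q (\<phi> x)) \<in> polys I M" by blast
  then have "(\<lambda>x. p (\<phi> x)) \<in> polys I (max L M)" "(\<lambda>x. q (\<phi> x)) \<in> polys I (max L M)"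
    by (auto intro: polys_mono[rotated])
  then show ?case using polys_add by blast
next
  case (mult p q)
  then show ?case using polys_mult by blast
qed

section \<open>Zero loci in projective space\<close>

lemma homogeneous_zero_on_proj_point:
  assumes "vector_space s" "p \<in> homogeneous_poly_fun s" "v \<noteq> 0"
  shows "(\<forall>w\<in>proj_point s v - {0}. p w = 0) \<longleftrightarrow> p v = 0"
proof -
  interpret vector_space s by fact
  obtain d where d: "\<And>k v. p (s k v) = k ^ d * p v"
    using assms(2) unfolding homogeneous_poly_fun_def by blast
  have "v \<in> proj_point s v - {0}" using assms(3) by (simp add: proj_point_def span_base)
  then show ?thesis by (auto simp: proj_point_def span_singleton d)
qed

text \<open>By homogeneity one representative decides vanishing on the whole line, so membership in
  a closed set can be tested on the vector that the family produces.\<close>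

lemma proj_point_in_zero_locus:
  assumes "vector_space s" "P \<subseteq> homogeneous_poly_fun s" "v \<noteq> 0"
  shows "proj_point s v \<in> {L \<in> proj_space s. \<forall>p\<in>P. \<forall>v\<in>L - {0}. p v = 0} \<longleftrightarrow> (\<forall>p\<in>P. p v = 0)"
proof -
  have "proj_point s v \<in> proj_space s" using assms(3) unfolding proj_space_def by blast
  moreover have "(\<forall>w\<in>proj_point s v - {0}. p w = 0) \<longleftrightarrow> p v = 0" if "p \<in> P" for p
    using homogeneous_zero_on_proj_point[OF assms(1) _ assms(3)] assms(2) that by blast
  ultimately show ?thesis by simp
qed

lemma topspace_proj_zariski:
  assumes "vector_space s"
  shows "topspace (proj_zariski s) = proj_space s"
proof -
  interpret vector_space s by fact
  have one: "(\<lambda>_. 1) \<in> homogeneous_poly_fun s"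
    unfolding homogeneous_poly_fun_def by (auto intro!: poly_fun.const exI[of _ 0])
  have "proj_space s = proj_space s - {L \<in> proj_space s. \<forall>p\<in>{\<lambda>_. 1}. \<forall>v\<in>L - {0}. p v = (0::complex)}"
    by (auto simp: proj_space_def proj_point_def intro: span_base)
  then have "proj_zariski_open s (proj_space s)"
    unfolding proj_zariski_open_def using one by blast
  then have "openin (proj_zariski s) (proj_space s)" by (simp add: openin_proj_zariski assms)
  moreover have "U \<subseteq> proj_space s" if "openin (proj_zariski s) U" for U
    using that by (auto simp: openin_proj_zariski assms proj_zariski_open_def)
  ultimately show ?thesis by (meson openin_subset openin_topspace subset_antisym)
qed

lemma closedin_proj_zariski:
  assumes "vector_space s"
  shows "closedin (proj_zariski s) C \<longleftrightarrow>
    (\<exists>P \<subseteq> homogeneous_poly_fun s. C = {L \<in> proj_space s. \<forall>p\<in>P. \<forall>v\<in>L - {0}. p v = 0})"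
    (is "?lhs \<longleftrightarrow> ?rhs")
proof
  assume ?lhs
  then have C: "C \<subseteq> proj_space s" "proj_zariski_open s (proj_space s - C)"
    by (simp_all add: closedin_def topspace_proj_zariski openin_proj_zariski assms)
  then obtain P where P: "P \<subseteq> homogeneous_poly_fun s"
    "proj_space s - C = proj_space s - {L \<in> proj_space s. \<forall>p\<in>P. \<forall>v\<in>L - {0}. p v = 0}"
    unfolding proj_zariski_open_def by blast
  from P(2) have "C = {L \<in> proj_space s. \<forall>p\<in>P. \<forall>v\<in>L - {0}. p v = 0}"
    using C(1) by blast
  then show ?rhs using P(1) by blast
next
  assume ?rhs
  then show ?lhs
    by (auto simp: closedin_def topspace_proj_zariski openin_proj_zariski assms proj_zariski_open_def)
qed

section \<open>Chains of irreducible closed sets\<close>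

lemma krull_dim_subtopology_ge:
  assumes "\<And>i. i \<le> d \<Longrightarrow> closedin X (Z i) \<and> irreducible_in X (Z i) \<and> Z i \<subseteq> Q"
    and "\<And>i. i < d \<Longrightarrow> Z i \<subset> Z (Suc i)"
  shows "ereal (real d) \<le> krull_dim (subtopology X Q)"
proof -
  have "irreducible_in (subtopology X Q) (Z i)" if "i \<le> d" for i
    unfolding irreducible_in_def
  proof (intro conjI allI impI)
    have irr: "irreducible_in X (Z i)" "Z i \<subseteq> Q" using assms(1)[OF that] by auto
    then show "Z i \<subseteq> topspace (subtopology X Q)" "Z i \<noteq> {}"
      by (auto simp: irreducible_in_def topspace_subtopology)
    fix C D assume "closedin (subtopology X Q) C \<and> closedin (subtopology X Q) D \<and> Z i \<subseteq> C \<union> D"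
    \<comment> \<open>Closed sets of the subspace are traces of closed sets of \<open>X\<close>;
      since \<open>Z i\<close> lies in \<open>Q\<close>, irreducibility in \<open>X\<close> decides
      between these.\<close>
    then obtain C' D' where C': "closedin X C'" "C = C' \<inter> Q" "closedin X D'" "D = D' \<inter> Q" "Z i \<subseteq> C \<union> D"
      by (auto simp: closedin_subtopology)
    then have "Z i \<subseteq> C' \<or> Z i \<subseteq> D'" using irr unfolding irreducible_in_def by blast
    then show "Z i \<subseteq> C \<or> Z i \<subseteq> D" using C' irr by blast
  qed
  moreover have "closedin (subtopology X Q) (Z i)" if "i \<le> d" for i
    using assms(1)[OF that] by (simp add: closedin_subset_topspace)
  ultimately show ?thesis
    unfolding krull_dim_def using assms(2) by (intro Sup_upper) blast
qed

text \<open>Testing polynomiality against linear forms avoids choosing coordinates on the target.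
  \<open>D\<close> singles out parameters, the origin among them, at which the family has a
  projective point; in the application it also ensures maximal border subrank.\<close>

locale polynomial_family =
  fixes s :: "complex \<Rightarrow> 'v::ab_group_add \<Rightarrow> 'v" and I :: "'i set"
    and \<phi> :: "('i \<Rightarrow> complex) \<Rightarrow> 'v" and D :: "('i \<Rightarrow> complex) \<Rightarrow> complex" and K L :: nat
  assumes vs: "vector_space s" and fin: "finite I"
    and polys_linear_form: "\<And>\<psi>. Vector_Spaces.linear s (*) \<psi> \<Longrightarrow> (\<lambda>x. \<psi> (\<phi> x)) \<in> polys I K"
    and polys_D: "D \<in> polys I L" and D_0: "D (\<lambda>_. 0) \<noteq> 0"
    and nonzero: "\<And>x. D x \<noteq> 0 \<Longrightarrow> \<phi> x \<noteq> 0"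
begin

definition pts :: "'i set \<Rightarrow> 'v set set" where
  "pts J = {proj_point s (\<phi> (restr J x)) |x. D (restr J x) \<noteq> 0}"

definition Z :: "'i set \<Rightarrow> 'v set set" where
  "Z J = proj_zariski s closure_of pts J"

lemma pts_subset: "pts J \<subseteq> topspace (proj_zariski s)"
  using nonzero by (auto simp: pts_def topspace_proj_zariski[OF vs] proj_space_def)

lemma pts_subset_Z: "pts J \<subseteq> Z J"
  unfolding Z_def by (rule closure_of_subset[OF pts_subset])

lemma closedin_Z: "closedin (proj_zariski s) (Z J)"
  by (simp add: Z_def)

lemma Z_minimal: "closedin (proj_zariski s) C \<Longrightarrow> pts J \<subseteq> C \<Longrightarrow> Z J \<subseteq> C"
  unfolding Z_def by (rule closure_of_minimal)

lemma Z_mono: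
  assumes "J \<subseteq> J'"
  shows "Z J \<subseteq> Z J'"
proof -
  have "restr J x = restr J' (restr J x)" for x
    using assms by (auto simp: restr_def fun_eq_iff)
  then have "pts J \<subseteq> pts J'" unfolding pts_def by (smt (verit) mem_Collect_eq subsetI)
  then show ?thesis unfolding Z_def by (rule closure_of_mono)
qed

lemma polys_homogeneous_restr:
  assumes "p \<in> homogeneous_poly_fun s" "J \<subseteq> I"
  shows "\<exists>M. (\<lambda>x. p (\<phi> (restr J x))) \<in> polys J M"
proof -
  obtain M where "(\<lambda>x. p (\<phi> x)) \<in> polys I M"
    using poly_fun_compose_polys[of p s \<phi> I K] polys_linear_form assms(1)
    unfolding homogeneous_poly_fun_def by blast
  from polys_restr[OF fin assms(2) this] show ?thesis by blast
qed

text \<open>\<open>pts J\<close> is the image of an open subset of affine space. Two polynomials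
  witnessing that neither closed set contains it, one of them multiplied by \<open>D\<close>, are
  nonzero at a common parameter, which gives a point of \<open>pts J\<close> outside both.\<close>

lemma irreducible_Z:
  assumes J: "J \<subseteq> I"
  shows "irreducible_in (proj_zariski s) (Z J)"
  unfolding irreducible_in_def
proof (intro conjI allI impI)
  show "Z J \<subseteq> topspace (proj_zariski s)" using closedin_Z by (rule closedin_subset)
  have "proj_point s (\<phi> (restr J (\<lambda>_. 0))) \<in> pts J"
    using D_0 unfolding pts_def by (intro CollectI exI[of _ "\<lambda>_. 0"]) (simp add: restr_def)
  then show "Z J \<noteq> {}" using pts_subset_Z by blast
  fix C E assume CE: "closedin (proj_zariski s) C \<and> closedin (proj_zariski s) E \<and> Z J \<subseteq> C \<union> E"
  obtain P where P: "P \<subseteq> homogeneous_poly_fun s" "C = {L \<in> proj_space s. \<forall>p\<in>P. \<forall>v\<in>L - {0}. p v = 0}"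
    using CE unfolding closedin_proj_zariski[OF vs] by blast
  obtain R where R: "R \<subseteq> homogeneous_poly_fun s" "E = {L \<in> proj_space s. \<forall>p\<in>R. \<forall>v\<in>L - {0}. p v = 0}"
    using CE unfolding closedin_proj_zariski[OF vs] by blast
  have in_C: "proj_point s v \<in> C \<longleftrightarrow> (\<forall>p\<in>P. p v = 0)" and in_E: "proj_point s v \<in> E \<longleftrightarrow> (\<forall>p\<in>R. p v = 0)"
    if "v \<noteq> 0" for v
    unfolding P(2) R(2) using proj_point_in_zero_locus[OF vs _ that] P(1) R(1) by blast+
  have "pts J \<subseteq> C \<or> pts J \<subseteq> E"
  proof (rule ccontr)
    assume "\<not> (pts J \<subseteq> C \<or> pts J \<subseteq> E)"
    then obtain x y where xy: "D (restr J x) \<noteq> 0" "proj_point s (\<phi> (restr J x)) \<notin> C"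
      "D (restr J y) \<noteq> 0" "proj_point s (\<phi> (restr J y)) \<notin> E"
      unfolding pts_def by blast
    obtain p where p: "p \<in> P" "p (\<phi> (restr J x)) \<noteq> 0"
      using xy(2) in_C[OF nonzero[OF xy(1)]] by blast
    obtain r where r: "r \<in> R" "r (\<phi> (restr J y)) \<noteq> 0"
      using xy(4) in_E[OF nonzero[OF xy(3)]] by blast
    obtain M N where "(\<lambda>x. p (\<phi> (restr J x))) \<in> polys J M" "(\<lambda>x. r (\<phi> (restr J x))) \<in> polys J N"
      using polys_homogeneous_restr[OF _ J] p(1) r(1) P(1) R(1) by blast
    from polys_mult[OF this(1) polys_restr[OF fin J polys_D]] this(2)
    obtain z where z: "p (\<phi> (restr J z)) * D (restr J z) \<noteq> 0" "r (\<phi> (restr J z)) \<noteq> 0"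
      using polys_common_nonzero[of "\<lambda>x. p (\<phi> (restr J x)) * D (restr J x)" J _ x
          "\<lambda>x. r (\<phi> (restr J x))" _ y] p r xy by auto
    then have "D (restr J z) \<noteq> 0" by simp
    then have "proj_point s (\<phi> (restr J z)) \<in> pts J" unfolding pts_def by blast
    then have "proj_point s (\<phi> (restr J z)) \<in> C \<union> E" using CE pts_subset_Z by blast
    then show False
      using z p(1) r(1) in_C[OF nonzero[OF \<open>D (restr J z) \<noteq> 0\<close>]] in_E[OF nonzero[OF \<open>D (restr J z) \<noteq> 0\<close>]]
      by auto
  qed
  then show "Z J \<subseteq> C \<or> Z J \<subseteq> E" using Z_minimal CE by blast
qed

text \<open>The quotients \<open>y i / q\<close> act as local coordinates in which the family is the
  identity to first order at the origin. On the subfamily of \<open>J\<close> the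
  \<open>card J + 1\<close> forms indexed by \<open>insert j J\<close> satisfy a homogeneous
  relation \<open>F\<close> together with \<open>q\<close>; a point on a suitable ray of the larger
  subfamily violates it.\<close>

lemma Z_strict:
  fixes y :: "'i \<Rightarrow> 'v \<Rightarrow> complex" and q :: "'v \<Rightarrow> complex"
  assumes J: "J \<subseteq> I" and j: "j \<in> I" "j \<notin> J"
    and y: "\<And>i. i \<in> I \<Longrightarrow> Vector_Spaces.linear s (*) (y i)" and q: "Vector_Spaces.linear s (*) q"
    and y_lim: "\<And>i v. i \<in> I \<Longrightarrow> ((\<lambda>t. y i (\<phi> (\<lambda>i. t * v i)) / t) \<longlongrightarrow> v i) (at 0)"
    and q_lim: "\<And>v. ((\<lambda>t. q (\<phi> (\<lambda>i. t * v i))) \<longlongrightarrow> 1) (at 0)"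
  shows "Z J \<subset> Z (insert j J)"
proof -
  let ?L = "insert j J"
  have LI: "?L \<subseteq> I" using J j by blast
  have finJ: "finite J" "finite ?L" using finite_subset[OF J fin] by auto
  have card: "card J < card ?L" using j finJ by simp
  have y_polys: "\<forall>l\<in>?L. (\<lambda>x. y l (\<phi> (restr J x))) \<in> polys J K"
    using polys_restr[OF fin J polys_linear_form[OF y]] LI by blast
  from homogeneous_relation[where y = "\<lambda>l x. y l (\<phi> (restr J x))", OF finJ card y_polys polys_restr[OF fin J polys_linear_form[OF q]]]
  obtain E k where k: "\<exists>\<alpha>\<in>?L \<rightarrow>\<^sub>E {..E}. k \<alpha> \<noteq> (0::complex)"
    and rel: "\<forall>x. (\<Sum>\<alpha>\<in>?L \<rightarrow>\<^sub>E {..E}. k \<alpha> * (monomial ?L \<alpha> (\<lambda>l. y l (\<phi> (restr J x))) *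
      q (\<phi> (restr J x)) ^ (E * card ?L - (\<Sum>l\<in>?L. \<alpha> l)))) = 0"
    by (elim exE conjE) (rule that)
  \<comment> \<open>The degree of homogeneity of \<open>F\<close>: the powers of \<open>q\<close>
    fill up each monomial in the \<open>y l\<close> to degree \<open>M\<close>.\<close>
  define M where "M = E * card ?L"
  define F where "F w = (\<Sum>\<alpha>\<in>?L \<rightarrow>\<^sub>E {..E}. k \<alpha> * (monomial ?L \<alpha> (\<lambda>l. y l w) * q w ^ (M - (\<Sum>l\<in>?L. \<alpha> l))))" for w
  have "F \<in> poly_fun s"
    unfolding F_def[abs_def] monomial_def using y q LI
    by (intro poly_fun_sum poly_fun.mult poly_fun_prod poly_fun_power poly_fun.const poly_fun.linear_form) auto
  moreover have "F (s c w) = c ^ M * F w" for c w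
    unfolding F_def sum_distrib_left
  proof (intro sum.cong refl)
    fix \<alpha> assume \<alpha>: "\<alpha> \<in> ?L \<rightarrow>\<^sub>E {..E}"
    have le: "(\<Sum>l\<in>?L. \<alpha> l) \<le> M"
      using sum_bounded_above[of ?L \<alpha> E] \<alpha> by (auto simp: mult.commute PiE_iff M_def simp del: sum.insert)
    have "monomial ?L \<alpha> (\<lambda>l. y l (s c w)) = (\<Prod>l\<in>?L. c ^ \<alpha> l * y l w ^ \<alpha> l)"
      unfolding monomial_def using LI
      by (intro prod.cong refl) (auto simp: linear_map_scale[OF y] power_mult_distrib subset_iff)
    also have "\<dots> = c ^ (\<Sum>l\<in>?L. \<alpha> l) * monomial ?L \<alpha> (\<lambda>l. y l w)"
      by (simp only: prod.distrib monomial_def power_sum)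
    finally show "k \<alpha> * (monomial ?L \<alpha> (\<lambda>l. y l (s c w)) * q (s c w) ^ (M - (\<Sum>l\<in>?L. \<alpha> l))) =
        c ^ M * (k \<alpha> * (monomial ?L \<alpha> (\<lambda>l. y l w) * q w ^ (M - (\<Sum>l\<in>?L. \<alpha> l))))"
      using power_add[of c "\<Sum>l\<in>?L. \<alpha> l" "M - (\<Sum>l\<in>?L. \<alpha> l)"] le
      by (simp add: linear_map_scale[OF q] power_mult_distrib del: sum.insert)
  qed
  ultimately have F: "F \<in> homogeneous_poly_fun s" unfolding homogeneous_poly_fun_def by blast
  let ?C = "{L \<in> proj_space s. \<forall>p\<in>{F}. \<forall>v\<in>L - {0}. p v = 0}"
  have C: "closedin (proj_zariski s) ?C"
    unfolding closedin_proj_zariski[OF vs] using F by blast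
  have in_C: "proj_point s v \<in> ?C \<longleftrightarrow> F v = 0" if "v \<noteq> 0" for v
    using proj_point_in_zero_locus[OF vs _ that, of "{F}"] F by simp
  have "pts J \<subseteq> ?C"
    unfolding pts_def using in_C nonzero rel by (auto simp: F_def M_def simp del: sum.insert)
  from Z_minimal[OF C this] have ZJ: "Z J \<subseteq> ?C" .
  obtain v where v: "\<forall>y r. (\<forall>l\<in>?L. ((\<lambda>t. y t l / t) \<longlongrightarrow> v l) (at 0)) \<longrightarrow> (r \<longlongrightarrow> 1) (at 0) \<longrightarrow>
    eventually (\<lambda>t::complex. (\<Sum>\<alpha>\<in>?L \<rightarrow>\<^sub>E {..E}. k \<alpha> * (monomial ?L \<alpha> (y t) * r t ^ (M - (\<Sum>l\<in>?L. \<alpha> l)))) \<noteq> 0) (at 0)"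
    using relation_nonzero_along_curve[OF finJ(2), of _ E k M] k by blast
  \<comment> \<open>Restricting the ray is the same as restricting its direction, so the limit
    hypotheses apply to the direction \<open>restr ?L v\<close>, which agrees with \<open>v\<close>
    on \<open>?L\<close>.\<close>
  have restr_v: "restr ?L (\<lambda>i. t * v i) = (\<lambda>i. t * restr ?L v i)" for t
    by (auto simp: restr_def)
  have "eventually (\<lambda>t. F (\<phi> (restr ?L (\<lambda>i. t * v i))) \<noteq> 0) (at 0)"
    unfolding F_def
  proof (rule v[rule_format])
    fix l assume "l \<in> ?L"
    then show "((\<lambda>t. y l (\<phi> (restr ?L (\<lambda>i. t * v i))) / t) \<longlongrightarrow> v l) (at 0)"
      unfolding restr_v using y_lim[of l "restr ?L v"] LI by (auto simp: restr_def)
  next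
    show "((\<lambda>t. q (\<phi> (restr ?L (\<lambda>i. t * v i)))) \<longlongrightarrow> 1) (at 0)"
      unfolding restr_v by (rule q_lim)
  qed
  \<comment> \<open>On the ray \<open>D\<close> is a polynomial in \<open>t\<close> that is nonzero
    at 0, so small \<open>t\<close> also avoid its zeros.\<close>
  moreover have "eventually (\<lambda>t. D (restr ?L (\<lambda>i. t * v i)) \<noteq> 0) (at 0)"
  proof -
    obtain p where p: "\<And>t. D (\<lambda>i. 0 + t * restr ?L v i) = poly p t"
      using polys_on_line[OF polys_D, of "\<lambda>_. 0" "restr ?L v"] by blast
    have "(poly p \<longlongrightarrow> poly p 0) (at 0)" using isCont_def poly_isCont by blast
    moreover have "poly p 0 \<noteq> 0" using p[of 0] D_0 by simp
    ultimately show ?thesis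
      unfolding restr_v using p by (auto dest: tendsto_imp_eventually_ne)
  qed
  ultimately have "eventually (\<lambda>t. F (\<phi> (restr ?L (\<lambda>i. t * v i))) \<noteq> 0 \<and> D (restr ?L (\<lambda>i. t * v i)) \<noteq> 0) (at 0)"
    by (rule eventually_conj)
  then obtain t where t: "F (\<phi> (restr ?L (\<lambda>i. t * v i))) \<noteq> 0" "D (restr ?L (\<lambda>i. t * v i)) \<noteq> 0"
    using eventually_happens[of _ "at (0::complex)"] by auto
  then have "proj_point s (\<phi> (restr ?L (\<lambda>i. t * v i))) \<in> Z ?L"
    using pts_subset_Z[of ?L] unfolding pts_def by blast
  moreover have "proj_point s (\<phi> (restr ?L (\<lambda>i. t * v i))) \<notin> ?C"
    using in_C[OF nonzero[OF t(2)]] t(1) by blast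
  ultimately show ?thesis using ZJ Z_mono[of J ?L] by blast
qed

text \<open>Switching on parameters one at a time along an enumeration gives \<open>card I\<close>
  strict inclusions, beginning with the closure of the single point at the origin. As
  \<open>Q\<close> is closed and contains the family, it contains the whole chain.\<close>

lemma krull_dim_ge_card:
  fixes y :: "'i \<Rightarrow> 'v \<Rightarrow> complex" and q :: "'v \<Rightarrow> complex"
  assumes y: "\<And>i. i \<in> I \<Longrightarrow> Vector_Spaces.linear s (*) (y i)" and q: "Vector_Spaces.linear s (*) q"
    and y_lim: "\<And>i v. i \<in> I \<Longrightarrow> ((\<lambda>t. y i (\<phi> (\<lambda>i. t * v i)) / t) \<longlongrightarrow> v i) (at 0)"
    and q_lim: "\<And>v. ((\<lambda>t. q (\<phi> (\<lambda>i. t * v i))) \<longlongrightarrow> 1) (at 0)"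
    and Q: "closedin (proj_zariski s) Q" "\<And>x. D x \<noteq> 0 \<Longrightarrow> proj_point s (\<phi> x) \<in> Q"
  shows "ereal (real (card I)) \<le> krull_dim (subtopology (proj_zariski s) Q)"
proof -
  obtain h where h: "bij_betw h {0..<card I} I"
    using ex_bij_betw_nat_finite[OF fin] by blast
  have hI: "h ` {0..<m} \<subseteq> I" if "m \<le> card I" for m
    using bij_betw_imp_surj_on[OF h] that by auto
  show ?thesis
  proof (rule krull_dim_subtopology_ge[of _ _ "\<lambda>m. Z (h ` {0..<m})"])
    fix m assume "m \<le> card I"
    then show "closedin (proj_zariski s) (Z (h ` {0..<m})) \<and>
        irreducible_in (proj_zariski s) (Z (h ` {0..<m})) \<and> Z (h ` {0..<m}) \<subseteq> Q"
      using closedin_Z irreducible_Z[OF hI] Z_minimal[OF Q(1)] Q(2) by (auto simp: pts_def)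
  next
    fix m assume m: "m < card I"
    have "h m \<notin> h ` {0..<m}"
      using bij_betw_imp_inj_on[OF h] m by (fastforce simp: inj_on_def)
    moreover have "h m \<in> I" using bij_betwE[OF h] m by auto
    ultimately show "Z (h ` {0..<m}) \<subset> Z (h ` {0..<Suc m})"
      using Z_strict[OF hI[of m] _ _ y q y_lim q_lim, of "h m"] m
      by (simp add: atLeast0_lessThan_Suc)
  qed
qed

end

section \<open>Linear maps, tensors and degenerations\<close>

lemma dual_family:
  assumes "vector_space s" "basis_family s n e"
  shows "\<exists>\<delta>. \<forall>i\<in>{1..n}. Vector_Spaces.linear s (*) (\<delta> i) \<and> (\<forall>j\<in>{1..n}. \<delta> i (e j) = (if i = j then 1 else 0))"
proof (intro bchoice ballI)
  fix i assume i: "i \<in> {1..n}"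
  obtain \<phi> where "Vector_Spaces.linear s (*) \<phi>" "\<And>x. x \<in> e ` {1..n} \<Longrightarrow> \<phi> x = (if x = e i then 1 else 0)"
    using linear_functional_extend[OF assms(1), of "e ` {1..n}" "\<lambda>x. if x = e i then 1 else 0"] assms(2)
    unfolding basis_family_def by blast
  moreover have "e j = e i \<longleftrightarrow> i = j" if "j \<in> {1..n}" for j
    using assms(2) i that by (auto simp: basis_family_def dest: inj_onD)
  ultimately show "\<exists>\<phi>. Vector_Spaces.linear s (*) \<phi> \<and> (\<forall>j\<in>{1..n}. \<phi> (e j) = (if i = j then 1 else 0))"
    by (intro exI[of _ \<phi>]) simp
qed

text \<open>The rank \<rho> lets one lemma cover upper triangular, lower triangular and diagonal
  matrices. By induction on the rank each \<open>e i\<close> lies in the range, because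
  \<open>F (e i)\<close> differs from a nonzero multiple of it by vectors of lower rank; finite
  dimension then gives injectivity.\<close>

lemma triangular_general_linear:
  fixes s :: "complex \<Rightarrow> 'a::ab_group_add \<Rightarrow> 'a" and \<rho> :: "nat \<Rightarrow> nat"
  assumes "vector_space s" and e: "basis_family s n e"
    and diag: "\<And>i. i \<in> {1..n} \<Longrightarrow> g i i \<noteq> 0"
    and tri: "\<And>l i. l \<in> {1..n} \<Longrightarrow> i \<in> {1..n} \<Longrightarrow> l \<noteq> i \<Longrightarrow> g l i \<noteq> 0 \<Longrightarrow> \<rho> l < \<rho> i"
  shows "\<exists>F\<in>general_linear s. \<forall>i\<in>{1..n}. F (e i) = (\<Sum>l=1..n. s (g l i) (e l))"
proof -
  interpret vector_space s by fact
  interpret vp: vector_space_pair s s ..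
  interpret finite_dimensional_vector_space s "e ` {1..n}"
    using e by unfold_locales (auto simp: basis_family_def)
  have inj: "inj_on e {1..n}" using e by (simp add: basis_family_def)
  obtain F where F: "Vector_Spaces.linear s s F"
    and Fe: "\<And>x. x \<in> e ` {1..n} \<Longrightarrow> F x = (\<Sum>l=1..n. s (g l (the_inv_into {1..n} e x)) (e l))"
    using vp.linear_independent_extend[OF independent_Basis,
        of "\<lambda>x. \<Sum>l=1..n. s (g l (the_inv_into {1..n} e x)) (e l)"] by blast
  have Fe: "F (e i) = (\<Sum>l=1..n. s (g l i) (e l))" if "i \<in> {1..n}" for i
    using Fe[of "e i"] that by (simp only: the_inv_into_f_f[OF inj that] imageI)
  have sub: "subspace (range F)"
    using vp.linear_subspace_image[OF F subspace_UNIV] .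
  have "e i \<in> range F" if "i \<in> {1..n}" for i
    using that
  proof (induction "\<rho> i" arbitrary: i rule: less_induct)
    case less
    have "s (g l i) (e l) \<in> range F" if "l \<in> {1..n} - {i}" for l
    proof (cases "g l i = 0")
      case True
      then show ?thesis using subspace_0[OF sub] by simp
    next
      case False
      then show ?thesis using less tri[of l i] that subspace_scale[OF sub] by blast
    qed
    then have "(\<Sum>l\<in>{1..n}-{i}. s (g l i) (e l)) \<in> range F" by (intro subspace_sum[OF sub])
    moreover have "F (e i) = s (g i i) (e i) + (\<Sum>l\<in>{1..n}-{i}. s (g l i) (e l))"
      using Fe[OF less.prems] less.prems by (simp add: sum.remove)
    ultimately have "s (g i i) (e i) \<in> range F"
      using subspace_diff[OF sub rangeI, of "\<Sum>l\<in>{1..n}-{i}. s (g l i) (e l)" "e i"] by simp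
    from subspace_scale[OF sub this, of "inverse (g i i)"] show ?case
      using diag[OF less.prems] by simp
  qed
  then have "range F = UNIV"
    using span_minimal[OF _ sub, of "e ` {1..n}"] span_Basis by blast
  then have "bij F" using linear_surj_imp_inj[OF F] by (simp add: bij_def)
  then show ?thesis using F Fe by (auto simp: general_linear_def)
qed

lemma diagonal_general_linear:
  assumes "vector_space s" "basis_family s n e" "\<And>i. i \<in> {1..n} \<Longrightarrow> d i \<noteq> 0"
  shows "\<exists>F\<in>general_linear s. \<forall>i\<in>{1..n}. F (e i) = s (d i) (e i)"
proof -
  interpret vector_space s by fact
  obtain F where F: "F \<in> general_linear s"
    "\<And>i. i \<in> {1..n} \<Longrightarrow> F (e i) = (\<Sum>l=1..n. s (if l = i then d l else 0) (e l))"
    using triangular_general_linear[OF assms(1,2), of "\<lambda>l i. if l = i then d l else 0" id] assms(3) by auto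
  have "(\<Sum>l=1..n. s (if l = i then d l else 0) (e l)) = s (d i) (e i)" if "i \<in> {1..n}" for i
  proof -
    have "(\<Sum>l=1..n. s (if l = i then d l else 0) (e l)) = (\<Sum>l=1..n. if l = i then s (d l) (e l) else 0)"
      by (intro sum.cong) auto
    then show ?thesis using that by (simp only: sum.delta finite_atLeastAtMost if_True)
  qed
  then show ?thesis using F by (intro bexI[of _ F] ballI) simp_all
qed

lemma general_linear_compose:
  assumes "f \<in> general_linear s" "g \<in> general_linear s"
  shows "f \<circ> g \<in> general_linear s"
  using assms Vector_Spaces.linear_compose[of s s g s f] by (auto simp: general_linear_def bij_comp)

lemma general_linear_inv:
  assumes "f \<in> general_linear s"
  shows "inv f \<in> general_linear s"
proof -
  have f: "Vector_Spaces.linear s s f" "bij f" using assms by (auto simp: general_linear_def)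
  have ff: "f (inv f x) = x" "inv f (f x) = x" for x
    using f(2) by (simp_all add: bij_is_surj surj_f_inv_f bij_is_inj)
  have "f (inv f x + inv f y) = x + y" "f (s k (inv f x)) = s k x" for x y k
    using f(1) by (simp_all add: Vector_Spaces.linear_iff ff)
  then have "inv f (x + y) = inv f x + inv f y" "inv f (s k x) = s k (inv f x)" for x y k
    by (metis ff(2))+
  then show ?thesis
    using f by (simp add: general_linear_def Vector_Spaces.linear_iff bij_imp_bij_inv)
qed

section \<open>Zariski closures and polynomial curves\<close>

lemma topspace_zariski: "topspace (zariski s) = UNIV"
proof -
  have "zariski_open s UNIV"
    unfolding zariski_open_def using poly_fun.const[of 1 s] by (intro exI[of _ "{\<lambda>_. 1}"]) auto
  then have "openin (zariski s) UNIV" by (simp add: openin_zariski)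
  then show ?thesis using openin_subset by blast
qed

lemma in_zariski_closure:
  assumes "\<And>p. p \<in> poly_fun s \<Longrightarrow> (\<And>v. v \<in> S \<Longrightarrow> p v = 0) \<Longrightarrow> p w = 0"
  shows "w \<in> zariski s closure_of S"
  unfolding in_closure_of
proof (intro conjI allI impI)
  show "w \<in> topspace (zariski s)" by (simp add: topspace_zariski)
  fix U assume U: "w \<in> U \<and> openin (zariski s) U"
  then obtain P where P: "P \<subseteq> poly_fun s" "U = UNIV - {v. \<forall>p\<in>P. p v = 0}"
    unfolding openin_zariski zariski_open_def by blast
  then obtain p where "p \<in> P" "p w \<noteq> 0" using U by blast
  then obtain v where "v \<in> S" "p v \<noteq> 0" using assms P(1) by blast
  then show "\<exists>v. v \<in> S \<and> v \<in> U" using P(2) \<open>p \<in> P\<close> by blast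
qed

lemma poly_fun_on_curve:
  assumes "p \<in> poly_fun s" "\<And>\<psi>. Vector_Spaces.linear s (*) \<psi> \<Longrightarrow> \<exists>P. \<forall>t. \<psi> (R t) = poly P t"
  shows "\<exists>P. \<forall>t. p (R t) = poly P t"
  using assms(1)
proof (induction rule: poly_fun.induct)
  case (linear_form \<psi>)
  then show ?case using assms(2) by blast
next
  case (const k)
  show ?case by (intro exI[of _ "[:k:]"]) simp
next
  case (add p q)
  then obtain P Q where "\<forall>t. p (R t) = poly P t" "\<forall>t. q (R t) = poly Q t" by blast
  then show ?case by (intro exI[of _ "P + Q"]) simp
next
  case (mult p q)
  then obtain P Q where "\<forall>t. p (R t) = poly P t" "\<forall>t. q (R t) = poly Q t" by blast
  then show ?case by (intro exI[of _ "P * Q"]) simp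
qed

text \<open>A polynomial function vanishing on \<open>S\<close> becomes a univariate polynomial in
  \<open>t\<close> with every nonzero \<open>t\<close> as a root, hence zero, so it vanishes at
  \<open>R 0\<close> too.\<close>

lemma curve_limit_in_zariski_closure:
  assumes "\<And>\<psi>. Vector_Spaces.linear s (*) \<psi> \<Longrightarrow> \<exists>P. \<forall>t. \<psi> (R t) = poly P t"
    and "\<And>t. t \<noteq> 0 \<Longrightarrow> R t \<in> S"
  shows "R 0 \<in> zariski s closure_of S"
proof (rule in_zariski_closure)
  fix p assume p: "p \<in> poly_fun s" "\<And>v. v \<in> S \<Longrightarrow> p v = 0"
  have "\<exists>P. \<forall>t. p (R t) = poly P t"
    by (rule poly_fun_on_curve[OF p(1)]) (rule assms(1))
  then obtain P where P: "\<And>t. p (R t) = poly P t" by blast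
  have "UNIV - {0} \<subseteq> {t. poly P t = 0}" using p(2)[OF assms(2)] by (auto simp flip: P)
  moreover have "infinite (UNIV - {0::complex})" by (simp add: infinite_UNIV_char_0)
  ultimately have "P = 0" using poly_roots_finite finite_subset by blast
  then show "p (R 0) = 0" using P by simp
qed

section \<open>Coordinates on the tensor product\<close>

locale tensor_bases =
  fixes n :: nat
    and sA :: "complex \<Rightarrow> 'a::ab_group_add \<Rightarrow> 'a"
    and sB :: "complex \<Rightarrow> 'b::ab_group_add \<Rightarrow> 'b"
    and sC :: "complex \<Rightarrow> 'c::ab_group_add \<Rightarrow> 'c"
    and sV :: "complex \<Rightarrow> 'v::ab_group_add \<Rightarrow> 'v"
    and \<tau> :: "'a \<Rightarrow> 'b \<Rightarrow> 'c \<Rightarrow> 'v"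
    and a :: "nat \<Rightarrow> 'a" and b :: "nat \<Rightarrow> 'b" and c :: "nat \<Rightarrow> 'c"
  assumes n: "n \<ge> 1"
    and vsA: "vector_space sA" and vsB: "vector_space sB" and vsC: "vector_space sC"
    and vsV: "vector_space sV" and tensor: "tensor_product sA sB sC sV \<tau>"
    and a: "basis_family sA n a" and b: "basis_family sB n b" and c: "basis_family sC n c"
begin

lemma trilinear_tensor: "trilinear sA sB sC sV \<tau>"
  using tensor by (simp add: tensor_product_def)

lemma linear_tensor:
  "Vector_Spaces.linear sA sV (\<lambda>x. \<tau> x y z)"
  "Vector_Spaces.linear sB sV (\<lambda>y. \<tau> x y z)"
  "Vector_Spaces.linear sC sV (\<lambda>z. \<tau> x y z)"
  using trilinear_tensor by (simp_all add: trilinear_def)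

lemma tensor_map:
  assumes "Vector_Spaces.linear sA sA f" "Vector_Spaces.linear sB sB g" "Vector_Spaces.linear sC sC h"
  shows "Vector_Spaces.linear sV sV (tensor_map sV \<tau> f g h)"
    and "tensor_map sV \<tau> f g h (\<tau> x y z) = \<tau> (f x) (g y) (h z)"
proof -
  have "trilinear sA sB sC sV (\<lambda>x y z. \<tau> (f x) (g y) (h z))"
    using Vector_Spaces.linear_compose[OF assms(1) linear_tensor(1)]
      Vector_Spaces.linear_compose[OF assms(2) linear_tensor(2)]
      Vector_Spaces.linear_compose[OF assms(3) linear_tensor(3)]
    by (simp add: trilinear_def o_def)
  from theI'[OF tensor_product_universal[OF tensor this], folded tensor_map_def]
  show "Vector_Spaces.linear sV sV (tensor_map sV \<tau> f g h)"
    "tensor_map sV \<tau> f g h (\<tau> x y z) = \<tau> (f x) (g y) (h z)"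
    by simp_all
qed

definition coordA :: "nat \<Rightarrow> 'a \<Rightarrow> complex" where
  "coordA = (SOME \<delta>. \<forall>i\<in>{1..n}. Vector_Spaces.linear sA (*) (\<delta> i) \<and> (\<forall>j\<in>{1..n}. \<delta> i (a j) = (if i = j then 1 else 0)))"

definition coordB :: "nat \<Rightarrow> 'b \<Rightarrow> complex" where
  "coordB = (SOME \<delta>. \<forall>i\<in>{1..n}. Vector_Spaces.linear sB (*) (\<delta> i) \<and> (\<forall>j\<in>{1..n}. \<delta> i (b j) = (if i = j then 1 else 0)))"

definition coordC :: "nat \<Rightarrow> 'c \<Rightarrow> complex" where
  "coordC = (SOME \<delta>. \<forall>i\<in>{1..n}. Vector_Spaces.linear sC (*) (\<delta> i) \<and> (\<forall>j\<in>{1..n}. \<delta> i (c j) = (if i = j then 1 else 0)))"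

lemma coordA:
  assumes "i \<in> {1..n}"
  shows "Vector_Spaces.linear sA (*) (coordA i)" "j \<in> {1..n} \<Longrightarrow> coordA i (a j) = (if i = j then 1 else 0)"
  using bspec[OF someI_ex[OF dual_family[OF vsA a], folded coordA_def] assms] by simp_all

lemma coordB:
  assumes "i \<in> {1..n}"
  shows "Vector_Spaces.linear sB (*) (coordB i)" "j \<in> {1..n} \<Longrightarrow> coordB i (b j) = (if i = j then 1 else 0)"
  using bspec[OF someI_ex[OF dual_family[OF vsB b], folded coordB_def] assms] by simp_all

lemma coordC:
  assumes "i \<in> {1..n}"
  shows "Vector_Spaces.linear sC (*) (coordC i)" "j \<in> {1..n} \<Longrightarrow> coordC i (c j) = (if i = j then 1 else 0)"
  using bspec[OF someI_ex[OF dual_family[OF vsC c], folded coordC_def] assms] by simp_all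

text \<open>The product of three coordinate forms is trilinear, so the universal property yields the
  linear form that reads off one coefficient of a tensor.\<close>

lemma ex_coord:
  assumes "l \<in> {1..n}" "m \<in> {1..n}" "p \<in> {1..n}"
  shows "\<exists>\<psi>. Vector_Spaces.linear sV (*) \<psi> \<and> (\<forall>x y z. \<psi> (\<tau> x y z) = coordA l x * coordB m y * coordC p z)"
proof -
  have "trilinear sA sB sC (*) (\<lambda>x y z. coordA l x * coordB m y * coordC p z)"
    using coordA(1)[OF assms(1)] coordB(1)[OF assms(2)] coordC(1)[OF assms(3)]
    by (auto simp: trilinear_def Vector_Spaces.linear_iff algebra_simps)
  from tensor_product_universal[OF tensor this] show ?thesis by blast
qed

definition coord :: "nat \<Rightarrow> nat \<Rightarrow> nat \<Rightarrow> 'v \<Rightarrow> complex" where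
  "coord l m p = (SOME \<psi>. Vector_Spaces.linear sV (*) \<psi> \<and>
     (\<forall>x y z. \<psi> (\<tau> x y z) = coordA l x * coordB m y * coordC p z))"

lemma coord:
  assumes "l \<in> {1..n}" "m \<in> {1..n}" "p \<in> {1..n}"
  shows "Vector_Spaces.linear sV (*) (coord l m p)"
    "coord l m p (\<tau> x y z) = coordA l x * coordB m y * coordC p z"
  using someI_ex[OF ex_coord[OF assms], folded coord_def] by simp_all

end

section \<open>The family of tensors of maximal border subrank\<close>

text \<open>
  The parameter \<open>x (i, j, k)\<close> is named after the coordinate of the tensor that it moves to first order
  at the origin: \<open>k < max i j\<close> and \<open>i = j = k\<close> are the coefficients of the core tensor, the other
  three cases are the entries \<open>(i, k)\<close>, \<open>(j, k)\<close> and \<open>(k, i)\<close> of the unipotent matrices acting on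
  \<open>A\<close>, \<open>B\<close> and \<open>C\<close>.  The triple \<open>(1, 1, 1)\<close> is omitted because tensors are taken up to scalars.
\<close>

definition params :: "nat \<Rightarrow> (nat \<times> nat \<times> nat) set" where
  "params n = {(i, j, k). i \<in> {1..n} \<and> j \<in> {1..n} \<and> k \<in> {1..n} \<and>
     (k < max i j \<or> i = j \<and> j = k \<and> k \<noteq> 1 \<or> j = k \<and> i < k \<or> i = k \<and> j < k \<or> i = j \<and> i < k)}"

section \<open>Counting the parameters\<close>

lemma finite_params: "finite (params n)"
  by (rule finite_subset[of _ "{1..n} \<times> {1..n} \<times> {1..n}"]) (auto simp: params_def)

text \<open>At third index \<open>k\<close> there are \<open>n\<^sup>2 - k\<^sup>2\<close> pairs
  with \<open>k < max i j\<close>, the pair \<open>(k, k)\<close> unless \<open>k = 1\<close>, and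
  \<open>k - 1\<close> pairs from each of the three unipotent groups. The terms to be subtracted
  stand on the left so that the identity holds in the naturals.\<close>

lemma card_params_slice:
  assumes "k \<in> {1..n}"
  shows "card {(i, j). (i, j, k) \<in> params n} + k\<^sup>2 + (if k = 1 then 1 else 0) = n\<^sup>2 + 3 * (k - 1) + 1"
proof -
  let ?S = "{(i, j). (i, j, k) \<in> params n}"
  let ?U = "{1..n} \<times> {1..n} - {1..k} \<times> {1..k}"
  let ?d = "if k = 1 then {} else {(k, k)}"
  let ?A = "(\<lambda>i. (i, k)) ` {1..<k}" and ?B = "(\<lambda>i. (k, i)) ` {1..<k}" and ?C = "(\<lambda>i. (i, i)) ` {1..<k}"
  have S: "?S = ?U \<union> (?d \<union> (?A \<union> (?B \<union> ?C)))"
    using assms by (auto simp: params_def image_iff)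
  have "card (?B \<union> ?C) = card ?B + card ?C" by (intro card_Un_disjoint) auto
  moreover have "card (?A \<union> (?B \<union> ?C)) = card ?A + card (?B \<union> ?C)" by (intro card_Un_disjoint) auto
  moreover have "card (?d \<union> (?A \<union> (?B \<union> ?C))) = card ?d + card (?A \<union> (?B \<union> ?C))"
    by (intro card_Un_disjoint) auto
  moreover have "card (?U \<union> (?d \<union> (?A \<union> (?B \<union> ?C)))) = card ?U + card (?d \<union> (?A \<union> (?B \<union> ?C)))"
    using assms by (intro card_Un_disjoint) auto
  moreover have "card ?A = k - 1" "card ?B = k - 1" "card ?C = k - 1"
    by (subst card_image; simp add: inj_on_def)+
  moreover have "card ?U = n\<^sup>2 - k\<^sup>2"
    using assms by (subst card_Diff_subset) (auto simp: power2_eq_square)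
  ultimately have "card ?S = n\<^sup>2 - k\<^sup>2 + (card ?d + (k - 1 + (k - 1 + (k - 1))))"
    unfolding S by (simp only:)
  moreover have "k\<^sup>2 \<le> n\<^sup>2" using assms by simp
  moreover have "card ?d + (if k = 1 then 1 else 0) = 1" by simp
  ultimately show ?thesis by linarith
qed

lemma card_params:
  assumes "n \<ge> 1"
  shows "real (card (params n)) = (2 * real n ^ 3 + 3 * real n ^ 2 - 2 * real n - 3) / 3"
proof -
  let ?S = "\<lambda>k. {(i, j). (i, j, k) \<in> params n}"
  have fin: "finite (?S k)" for k
    by (rule finite_subset[of _ "{1..n} \<times> {1..n}"]) (auto simp: params_def)
  have eq: "params n = (\<lambda>(k, i, j). (i, j, k)) ` (SIGMA k:{1..n}. ?S k)"
  proof (intro set_eqI iffI)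
    fix t assume t: "t \<in> params n"
    obtain i j k where ijk: "t = (i, j, k)" by (cases t)
    then have "k \<in> {1..n}" using t by (simp add: params_def)
    then show "t \<in> (\<lambda>(k, i, j). (i, j, k)) ` (SIGMA k:{1..n}. ?S k)"
      using t ijk by (intro image_eqI[of _ _ "(k, i, j)"]) simp_all
  qed auto
  have "card (params n) = card (SIGMA k:{1..n}. ?S k)"
    by (rule trans[OF arg_cong[OF eq, of card] card_image]) (auto simp: inj_on_def)
  also have "\<dots> = (\<Sum>k=1..n. card (?S k))" using fin by (simp add: card_SigmaI)
  finally have "real (card (params n)) = (\<Sum>k=1..n. real (card (?S k)))" by simp
  also have "\<dots> = (\<Sum>k=1..n. real n ^ 2 + 3 * (real k - 1) + 1 - real k ^ 2 - (if k = 1 then 1 else 0))"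
  proof (intro sum.cong refl)
    fix k assume k: "k \<in> {1..n}"
    from arg_cong[OF card_params_slice[OF k], of real]
    show "real (card (?S k)) = real n ^ 2 + 3 * (real k - 1) + 1 - real k ^ 2 - (if k = 1 then 1 else 0)"
      using k by (simp add: of_nat_diff split: if_splits)
  qed
  also have "\<dots> = (\<Sum>k=1..n. real n ^ 2 + 3 * (real k - 1) + 1 - real k ^ 2) - 1"
    using assms by (simp add: sum_subtractf)
  \<comment> \<open>The upper limit is freed to \<open>m\<close> for the induction, while
    \<open>n\<close> in the summand stays fixed.\<close>
  also have "(\<Sum>k=1..m. real n ^ 2 + 3 * (real k - 1) + 1 - real k ^ 2) =
      m * real n ^ 2 + 3 * m * (real m - 1) / 2 + m - m * (m + 1) * (2 * m + 1) / 6" for m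
    by (induction m) (simp_all add: field_simps power2_eq_square)
  finally show ?thesis by (simp add: field_simps power2_eq_square power3_eq_cube)
qed

section \<open>The matrices, the core and their first-order expansion\<close>

definition matA :: "(nat \<times> nat \<times> nat \<Rightarrow> complex) \<Rightarrow> nat \<Rightarrow> nat \<Rightarrow> complex" where
  "matA x l i = (if l = i then 1 else if l < i then x (l, i, i) else 0)"

definition matB :: "(nat \<times> nat \<times> nat \<Rightarrow> complex) \<Rightarrow> nat \<Rightarrow> nat \<Rightarrow> complex" where
  "matB x l i = (if l = i then 1 else if l < i then x (i, l, i) else 0)"

text \<open>Lower triangular, while \<open>matA\<close> and \<open>matB\<close> are upper
  triangular: the condition \<open>k < max i j\<close> survives raising \<open>i\<close> or
  \<open>j\<close> and lowering \<open>k\<close>, and the matrices move the basis vectors the other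
  way, transversally to the core.\<close>

definition matC :: "(nat \<times> nat \<times> nat \<Rightarrow> complex) \<Rightarrow> nat \<Rightarrow> nat \<Rightarrow> complex" where
  "matC x l k = (if l = k then 1 else if k < l then x (k, k, l) else 0)"

text \<open>The shift by 1 puts the unit tensor at the origin of the parameter space; fixing the
  entry at \<open>(1, 1, 1)\<close> removes the scalar factor.\<close>

definition core :: "(nat \<times> nat \<times> nat \<Rightarrow> complex) \<Rightarrow> nat \<Rightarrow> nat \<Rightarrow> nat \<Rightarrow> complex" where
  "core x i j k = (if k < max i j then x (i, j, k)
     else if i = j \<and> j = k then (if k = 1 then 1 else 1 + x (k, k, k)) else 0)"

lemma polys_entries:
  assumes "i \<in> {1..n}" "j \<in> {1..n}" "k \<in> {1..n}"
  shows "(\<lambda>x. matA x i j) \<in> polys (params n) 1" "(\<lambda>x. matB x i j) \<in> polys (params n) 1"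
    "(\<lambda>x. matC x i j) \<in> polys (params n) 1" "(\<lambda>x. core x i j k) \<in> polys (params n) 1"
proof -
  have v: "(\<lambda>x. x t) \<in> polys (params n) 1" if "t \<in> params n" for t
    using polys_var[OF finite_params that] .
  have A: "(i, j, j) \<in> params n" "(j, i, j) \<in> params n" if "i < j"
    using that assms by (auto simp: params_def)
  have C: "(j, j, i) \<in> params n" if "j < i"
    using that assms by (auto simp: params_def)
  have W: "(i, j, k) \<in> params n" if "k < max i j"
    using that assms by (auto simp: params_def)
  have E: "(k, k, k) \<in> params n" if "k \<noteq> 1"
    using that assms by (auto simp: params_def)
  show "(\<lambda>x. matA x i j) \<in> polys (params n) 1"
    by (cases i j rule: linorder_cases) (simp_all add: matA_def polys_const v A del: One_nat_def)
  show "(\<lambda>x. matB x i j) \<in> polys (params n) 1"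
    by (cases i j rule: linorder_cases) (simp_all add: matB_def polys_const v A del: One_nat_def)
  show "(\<lambda>x. matC x i j) \<in> polys (params n) 1"
    by (cases i j rule: linorder_cases) (simp_all add: matC_def polys_const v C del: One_nat_def)
  show "(\<lambda>x. core x i j k) \<in> polys (params n) 1"
  proof (cases "k < max i j")
    case True
    then show ?thesis by (simp only: core_def if_True v W)
  next
    case False
    show ?thesis
    proof (cases "i = j \<and> j = k \<and> k \<noteq> 1")
      case True
      then show ?thesis using polys_add[OF polys_const[of 1] v[OF E]] by (simp add: core_def)
    next
      case F: False
      then have "(\<lambda>x. core x i j k) = (\<lambda>_. if i = j \<and> j = k then 1 else 0)"
        using False by (auto simp: core_def fun_eq_iff)
      then show ?thesis by (simp only: polys_const)
    qed
  qed
qed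

lemma sum_mult_delta:
  fixes f :: "nat \<Rightarrow> complex"
  assumes "l \<in> {1..n}"
  shows "(\<Sum>i=1..n. f i * (if l = i then 1 else 0)) = f l"
proof -
  have "(\<Sum>i=1..n. f i * (if l = i then 1 else 0)) = (\<Sum>i=1..n. if l = i then f i else 0)"
    by (intro sum.cong) auto
  then show ?thesis using assms by (simp only: sum.delta' finite_atLeastAtMost if_True)
qed

lemma sum3_delta:
  fixes f :: "nat \<Rightarrow> nat \<Rightarrow> nat \<Rightarrow> complex"
  assumes "l \<in> {1..n}" "m \<in> {1..n}" "p \<in> {1..n}"
  shows "(\<Sum>i=1..n. \<Sum>j=1..n. \<Sum>k=1..n. f i j k *
    ((if l = i then 1 else 0) * (if m = j then 1 else 0) * (if p = k then 1 else 0))) = f l m p"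
proof -
  have "(\<Sum>i=1..n. \<Sum>j=1..n. \<Sum>k=1..n. f i j k *
      ((if l = i then 1 else 0) * (if m = j then 1 else 0) * (if p = k then 1 else 0))) =
    (\<Sum>i=1..n. (\<Sum>j=1..n. (\<Sum>k=1..n. f i j k * (if p = k then 1 else 0)) * (if m = j then 1 else 0)) * (if l = i then 1 else 0))"
    unfolding sum_distrib_right by (intro sum.cong refl) (simp only: mult_ac)
  then show ?thesis using assms by (simp only: sum_mult_delta)
qed

lemma sum3_diagonal:
  fixes f :: "nat \<Rightarrow> nat \<Rightarrow> nat \<Rightarrow> complex"
  shows "(\<Sum>i=1..n. \<Sum>j=1..n. \<Sum>k=1..n. (if i = j \<and> j = k then 1 else 0) * f i j k) = (\<Sum>i=1..n. f i i i)"
proof (intro sum.cong refl)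
  fix i assume i: "i \<in> {1..n}"
  have "(\<Sum>j=1..n. \<Sum>k=1..n. (if i = j \<and> j = k then 1 else 0) * f i j k) =
      (\<Sum>j=1..n. (\<Sum>k=1..n. f i j k * (if j = k then 1 else 0)) * (if i = j then 1 else 0))"
    unfolding sum_distrib_right by (intro sum.cong refl) auto
  also have "\<dots> = (\<Sum>j=1..n. f i j j * (if i = j then 1 else 0))"
    by (intro sum.cong refl) (simp only: sum_mult_delta)
  finally show "(\<Sum>j=1..n. \<Sum>k=1..n. (if i = j \<and> j = k then 1 else 0) * f i j k) = f i i i"
    using i by (simp only: sum_mult_delta)
qed

lemma DERIV_product_of_affine:
  fixes w :: complex
  shows "((\<lambda>t. (w + t * w') * ((x + t * x') * (y + t * y') * (z + t * z'))) has_field_derivative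
    (w' * (x * y * z) + w * (x' * y * z + x * y' * z + x * y * z'))) (at 0)"
  by (rule DERIV_cong, (rule derivative_intros)+) (simp add: algebra_simps)

text \<open>The product rule differentiates one factor at a time, the others being deltas. The
  contributions of the core and of the three matrices fall on disjoint sets of coordinates, so each
  coordinate in \<open>params n\<close> receives exactly the parameter of its own name.\<close>

lemma DERIV_coefficient:
  assumes "l \<in> {1..n}" "m \<in> {1..n}" "p \<in> {1..n}"
  shows "((\<lambda>t. \<Sum>i=1..n. \<Sum>j=1..n. \<Sum>k=1..n. core (\<lambda>i. t * v i) i j k *
      (matA (\<lambda>i. t * v i) l i * matB (\<lambda>i. t * v i) m j * matC (\<lambda>i. t * v i) p k))
    has_field_derivative (if (l, m, p) \<in> params n then v (l, m, p) else 0)) (at 0)"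
proof -
  \<comment> \<open>All entries are affine in \<open>t\<close>: \<delta> is the value of the
    matrices at the origin, and \<open>A\<close>, \<open>B\<close>, \<open>C\<close>,
    \<open>W\<close> are the slopes.\<close>
  define \<delta> where "\<delta> i j = (if i = j then 1 else 0 :: complex)" for i j :: nat
  define A where "A l i = (if l < i then v (l, i, i) else 0)" for l i
  define B where "B l i = (if l < i then v (i, l, i) else 0)" for l i
  define C where "C l k = (if k < l then v (k, k, l) else 0)" for l k
  define W where "W i j k = (if k < max i j \<or> i = j \<and> j = k \<and> k \<noteq> 1 then v (i, j, k) else 0)" for i j k
  have eqs: "matA (\<lambda>i. t * v i) l i = \<delta> l i + t * A l i" "matB (\<lambda>i. t * v i) l i = \<delta> l i + t * B l i"
    "matC (\<lambda>i. t * v i) l i = \<delta> l i + t * C l i"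
    "core (\<lambda>i. t * v i) i j k = (if i = j \<and> j = k then 1 else 0) + t * W i j k" for t i j k l
    by (auto simp: matA_def matB_def matC_def core_def \<delta>_def A_def B_def C_def W_def)
  have "(\<Sum>i=1..n. \<Sum>j=1..n. \<Sum>k=1..n. W i j k * (\<delta> l i * \<delta> m j * \<delta> p k) +
      (if i = j \<and> j = k then 1 else 0) * (A l i * \<delta> m j * \<delta> p k + \<delta> l i * B m j * \<delta> p k + \<delta> l i * \<delta> m j * C p k))
    = W l m p + (\<Sum>i=1..n. A l i * \<delta> m i * \<delta> p i + \<delta> l i * B m i * \<delta> p i + \<delta> l i * \<delta> m i * C p i)"
    using sum3_delta[OF assms, of W, folded \<delta>_def] by (simp only: sum.distrib sum3_diagonal)
  also have "(\<Sum>i=1..n. A l i * \<delta> m i * \<delta> p i + \<delta> l i * B m i * \<delta> p i + \<delta> l i * \<delta> m i * C p i) =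
     (\<Sum>i=1..n. (A l i * \<delta> m i) * \<delta> p i) + (\<Sum>i=1..n. (\<delta> l i * B m i) * \<delta> p i) + (\<Sum>i=1..n. (\<delta> l i * C p i) * \<delta> m i)"
    by (simp add: sum.distrib mult_ac)
  also have "\<dots> = A l p * \<delta> m p + \<delta> l p * B m p + \<delta> l m * C p m"
    using sum_mult_delta[OF assms(3), folded \<delta>_def] sum_mult_delta[OF assms(2), folded \<delta>_def] by simp
  also have "W l m p + (A l p * \<delta> m p + \<delta> l p * B m p + \<delta> l m * C p m) =
      (if (l, m, p) \<in> params n then v (l, m, p) else 0)"
    using assms unfolding W_def A_def B_def C_def \<delta>_def params_def by auto
  finally show ?thesis
    unfolding eqs by (intro DERIV_cong[OF DERIV_sum[OF DERIV_sum[OF DERIV_sum[OF DERIV_product_of_affine]]]])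
qed

lemma coefficient_at_0:
  assumes "l \<in> {1..n}" "m \<in> {1..n}" "p \<in> {1..n}"
  shows "(\<Sum>i=1..n. \<Sum>j=1..n. \<Sum>k=1..n. core (\<lambda>i. 0 * v i) i j k *
      (matA (\<lambda>i. 0 * v i) l i * matB (\<lambda>i. 0 * v i) m j * matC (\<lambda>i. 0 * v i) p k)) = (if l = m \<and> m = p then 1 else 0)"
proof -
  have "core (\<lambda>i. 0 * v i) i j k = (if i = j \<and> j = k then 1 else 0)"
    "matA (\<lambda>i. 0 * v i) l i = (if l = i then 1 else 0)" "matB (\<lambda>i. 0 * v i) l i = (if l = i then 1 else 0)"
    "matC (\<lambda>i. 0 * v i) l i = (if l = i then 1 else 0)" for i j k l
    by (auto simp: core_def matA_def matB_def matC_def)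
  then show ?thesis using sum3_delta[OF assms, of "\<lambda>i j k. if i = j \<and> j = k then 1 else 0"] by (simp only:)
qed

section \<open>The family of tensors and its coordinates\<close>

context tensor_bases
begin

definition vecA :: "(nat \<times> nat \<times> nat \<Rightarrow> complex) \<Rightarrow> nat \<Rightarrow> 'a" where
  "vecA x i = (\<Sum>l=1..n. sA (matA x l i) (a l))"

definition vecB :: "(nat \<times> nat \<times> nat \<Rightarrow> complex) \<Rightarrow> nat \<Rightarrow> 'b" where
  "vecB x j = (\<Sum>l=1..n. sB (matB x l j) (b l))"

definition vecC :: "(nat \<times> nat \<times> nat \<Rightarrow> complex) \<Rightarrow> nat \<Rightarrow> 'c" where
  "vecC x k = (\<Sum>l=1..n. sC (matC x l k) (c l))"

definition family :: "(nat \<times> nat \<times> nat \<Rightarrow> complex) \<Rightarrow> 'v" where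
  "family x = (\<Sum>i=1..n. \<Sum>j=1..n. \<Sum>k=1..n. sV (core x i j k) (\<tau> (vecA x i) (vecB x j) (vecC x k)))"

text \<open>Where it is nonzero, the diagonal of the core can be rescaled to 1.\<close>

definition disc :: "(nat \<times> nat \<times> nat \<Rightarrow> complex) \<Rightarrow> complex" where
  "disc x = (\<Prod>i=1..n. core x i i i)"

lemma linear_form_vec:
  assumes \<psi>: "Vector_Spaces.linear sV (*) \<psi>"
  shows "\<psi> (\<tau> (vecA x i) (vecB x j) (vecC x k)) =
    (\<Sum>l=1..n. matA x l i * (\<Sum>m=1..n. matB x m j * (\<Sum>p=1..n. matC x p k * \<psi> (\<tau> (a l) (b m) (c p)))))"
proof -
  have "trilinear sA sB sC (*) (\<lambda>x y z. \<psi> (\<tau> x y z))"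
    using linear_compose_trilinear[OF trilinear_tensor \<psi>] .
  then have A: "Vector_Spaces.linear sA (*) (\<lambda>x. \<psi> (\<tau> x y z))"
    and B: "Vector_Spaces.linear sB (*) (\<lambda>y. \<psi> (\<tau> x y z))"
    and C: "Vector_Spaces.linear sC (*) (\<lambda>z. \<psi> (\<tau> x y z))" for x y z
    by (auto simp: trilinear_def)
  show ?thesis
    unfolding vecA_def linear_map_sum[OF A] linear_map_scale[OF A]
    unfolding vecB_def linear_map_sum[OF B] linear_map_scale[OF B]
    unfolding vecC_def linear_map_sum[OF C] linear_map_scale[OF C] ..
qed

lemma linear_form_family:
  assumes \<psi>: "Vector_Spaces.linear sV (*) \<psi>"
  shows "\<psi> (family x) = (\<Sum>i=1..n. \<Sum>j=1..n. \<Sum>k=1..n. core x i j k * \<psi> (\<tau> (vecA x i) (vecB x j) (vecC x k)))"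
  unfolding family_def by (simp only: linear_map_sum[OF \<psi>] linear_map_scale[OF \<psi>])

text \<open>With \<open>Suc\<close> the bound counts the factors of a summand: one core coefficient
  and three matrix entries give the 4 of \<open>polys_family\<close>.\<close>

lemma polys_scaled_entry: "f \<in> polys J 1 \<Longrightarrow> g \<in> polys J m \<Longrightarrow> (\<lambda>x. f x * g x) \<in> polys J (Suc m)"
  using polys_mult[of f J 1 g m] by simp

lemma polys_family:
  assumes \<psi>: "Vector_Spaces.linear sV (*) \<psi>"
  shows "(\<lambda>x. \<psi> (family x)) \<in> polys (params n) 4"
proof -
  have "(\<lambda>x. \<psi> (family x)) \<in> polys (params n) (Suc (Suc (Suc (Suc 0))))"
    unfolding linear_form_family[OF \<psi>] linear_form_vec[OF \<psi>]
    by (intro polys_sum polys_scaled_entry polys_entries polys_const) (assumption | simp only: )+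
  then show ?thesis by (simp add: numeral_eq_Suc)
qed

lemma polys_disc: "disc \<in> polys (params n) (\<Sum>i=1..n. 1)"
  unfolding disc_def[abs_def] by (intro polys_prod polys_entries)

lemma disc_0: "disc (\<lambda>_. 0) \<noteq> 0"
  by (simp add: disc_def core_def)

lemma coord_family:
  assumes "l \<in> {1..n}" "m \<in> {1..n}" "p \<in> {1..n}"
  shows "coord l m p (family x) = (\<Sum>i=1..n. \<Sum>j=1..n. \<Sum>k=1..n. core x i j k *
    (matA x l i * matB x m j * matC x p k))"
proof -
  have A: "coordA l (vecA x i) = matA x l i" for i
  proof -
    have "coordA l (vecA x i) = (\<Sum>l'=1..n. matA x l' i * coordA l (a l'))"
      unfolding vecA_def by (simp only: linear_map_sum[OF coordA(1)[OF assms(1)]] linear_map_scale[OF coordA(1)[OF assms(1)]])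
    also have "\<dots> = (\<Sum>l'=1..n. matA x l' i * (if l = l' then 1 else 0))"
      by (intro sum.cong refl) (simp only: coordA(2)[OF assms(1)])
    finally show ?thesis by (simp only: sum_mult_delta[OF assms(1)])
  qed
  have B: "coordB m (vecB x i) = matB x m i" for i
  proof -
    have "coordB m (vecB x i) = (\<Sum>l'=1..n. matB x l' i * coordB m (b l'))"
      unfolding vecB_def by (simp only: linear_map_sum[OF coordB(1)[OF assms(2)]] linear_map_scale[OF coordB(1)[OF assms(2)]])
    also have "\<dots> = (\<Sum>l'=1..n. matB x l' i * (if m = l' then 1 else 0))"
      by (intro sum.cong refl) (simp only: coordB(2)[OF assms(2)])
    finally show ?thesis by (simp only: sum_mult_delta[OF assms(2)])
  qed
  have C: "coordC p (vecC x i) = matC x p i" for i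
  proof -
    have "coordC p (vecC x i) = (\<Sum>l'=1..n. matC x l' i * coordC p (c l'))"
      unfolding vecC_def by (simp only: linear_map_sum[OF coordC(1)[OF assms(3)]] linear_map_scale[OF coordC(1)[OF assms(3)]])
    also have "\<dots> = (\<Sum>l'=1..n. matC x l' i * (if p = l' then 1 else 0))"
      by (intro sum.cong refl) (simp only: coordC(2)[OF assms(3)])
    finally show ?thesis by (simp only: sum_mult_delta[OF assms(3)])
  qed
  show ?thesis
    unfolding linear_form_family[OF coord(1)[OF assms]] coord(2)[OF assms] A B C ..
qed

lemma DERIV_coord_family:
  assumes "l \<in> {1..n}" "m \<in> {1..n}" "p \<in> {1..n}"
  shows "((\<lambda>t. coord l m p (family (\<lambda>i. t * v i))) has_field_derivative
      (if (l, m, p) \<in> params n then v (l, m, p) else 0)) (at 0)"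
    and "coord l m p (family (\<lambda>i. 0 * v i)) = (if l = m \<and> m = p then 1 else 0)"
  unfolding coord_family[OF assms] by (rule DERIV_coefficient[OF assms], rule coefficient_at_0[OF assms])

lemma ex_GL_vec:
  "\<exists>F\<in>general_linear sA. \<forall>i\<in>{1..n}. F (a i) = vecA x i"
  "\<exists>F\<in>general_linear sB. \<forall>i\<in>{1..n}. F (b i) = vecB x i"
  "\<exists>F\<in>general_linear sC. \<forall>i\<in>{1..n}. F (c i) = vecC x i"
proof -
  show "\<exists>F\<in>general_linear sA. \<forall>i\<in>{1..n}. F (a i) = vecA x i"
    unfolding vecA_def
    by (rule triangular_general_linear[OF vsA a, where \<rho> = id]) (auto simp: matA_def split: if_splits)
  show "\<exists>F\<in>general_linear sB. \<forall>i\<in>{1..n}. F (b i) = vecB x i"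
    unfolding vecB_def
    by (rule triangular_general_linear[OF vsB b, where \<rho> = id]) (auto simp: matB_def split: if_splits)
  show "\<exists>F\<in>general_linear sC. \<forall>i\<in>{1..n}. F (c i) = vecC x i"
    unfolding vecC_def
    \<comment> \<open>The rank reverses the index order because \<open>matC\<close> is lower
      triangular; \<open>n - l\<close> does not truncate on indices up to \<open>n\<close>.\<close>
    by (rule triangular_general_linear[OF vsC c, where \<rho> = "\<lambda>l. n - l"]) (auto simp: matC_def split: if_splits)
qed

section \<open>Degeneration to the unit tensor\<close>

text \<open>
  The core tensor, with \<open>a i\<close> rescaled by \<open>1 / core x i i i\<close>, moved by the one-parameter subgroup with
  weights \<open>2^i\<close>, \<open>2^j\<close> and \<open>-2 * 2^k\<close>.  The exponent does not truncate, by \<open>weight_pos\<close>.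
\<close>

definition degeneration :: "(nat \<times> nat \<times> nat \<Rightarrow> complex) \<Rightarrow> complex \<Rightarrow> 'v" where
  "degeneration x t = (\<Sum>i=1..n. \<Sum>j=1..n. \<Sum>k=1..n.
     sV (if k < max i j then core x i j k / core x i i i * t ^ (2 ^ i + 2 ^ j - 2 * 2 ^ k)
         else if i = j \<and> j = k then 1 else 0) (\<tau> (a i) (b j) (c k)))"

text \<open>The reason for exponential weights: \<open>2 * 2 ^ k\<close> is at most the larger of
  the two powers on the right, and the other one makes the inequality strict.\<close>

lemma weight_pos:
  assumes "k < max i j"
  shows "2 * 2 ^ k < (2 ^ i + 2 ^ j :: nat)"
proof -
  have "2 ^ Suc k \<le> (2 :: nat) ^ max i j" using assms by (intro power_increasing) auto
  moreover have "(2 :: nat) ^ max i j < 2 ^ i + 2 ^ j" by (auto simp: max_def)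
  ultimately show ?thesis by simp
qed

lemma degeneration_0: "degeneration x 0 = unit_tensor \<tau> a b c n"
proof -
  interpret V: vector_space sV by (rule vsV)
  let ?e = "\<lambda>i j k. \<tau> (a i) (b j) (c k)"
  have "degeneration x 0 = (\<Sum>i=1..n. \<Sum>j=1..n. \<Sum>k=1..n. if i = j then if j = k then ?e i j k else 0 else 0)"
    unfolding degeneration_def
  proof (intro sum.cong refl)
    fix i j k
    show "sV (if k < max i j then core x i j k / core x i i i * 0 ^ (2 ^ i + 2 ^ j - 2 * 2 ^ k)
        else if i = j \<and> j = k then 1 else 0) (?e i j k) = (if i = j then if j = k then ?e i j k else 0 else 0)"
      using weight_pos[of k i j] by (auto simp: power_0_left)
  qed
  also have "\<dots> = (\<Sum>i=1..n. \<Sum>j=1..n. if i = j then ?e i j j else 0)"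
  proof (intro sum.cong refl)
    fix i j assume "j \<in> {1..n}"
    then show "(\<Sum>k=1..n. if i = j then if j = k then ?e i j k else 0 else 0) = (if i = j then ?e i j j else 0)"
      by (cases "i = j") (simp_all only: refl sum.delta' finite_atLeastAtMost if_True if_False sum.neutral_const)
  qed
  also have "\<dots> = (\<Sum>i=1..n. ?e i i i)"
    by (intro sum.cong refl) (simp only: sum.delta' finite_atLeastAtMost if_True)
  finally show ?thesis by (simp only: unit_tensor_def)
qed

text \<open>The inverses of \<open>F\<close>, \<open>G\<close>, \<open>H\<close> undo the unipotent
  maps and return the core, on which the diagonal maps \<open>f\<close>, \<open>g\<close>,
  \<open>h\<close> act as the rescaled one-parameter subgroup.\<close>

lemma degeneration_in_orbit:
  assumes x: "disc x \<noteq> 0" and t: "t \<noteq> 0"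
  shows "degeneration x t \<in> GL_orbit sA sB sC sV \<tau> (family x)"
    and "family x \<noteq> 0"
proof -
  have x: "core x i i i \<noteq> 0" if "i \<in> {1..n}" for i
    using x that by (auto simp: disc_def)
  obtain F where F: "F \<in> general_linear sA" "\<And>i. i \<in> {1..n} \<Longrightarrow> F (a i) = vecA x i"
    using ex_GL_vec(1) by blast
  obtain G where G: "G \<in> general_linear sB" "\<And>i. i \<in> {1..n} \<Longrightarrow> G (b i) = vecB x i"
    using ex_GL_vec(2) by blast
  obtain H where H: "H \<in> general_linear sC" "\<And>i. i \<in> {1..n} \<Longrightarrow> H (c i) = vecC x i"
    using ex_GL_vec(3) by blast
  \<comment> \<open>Dividing by \<open>core x i i i\<close> on the first factor alone sets all
    diagonal coefficients to 1.\<close>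
  obtain f where f: "f \<in> general_linear sA" "\<And>i. i \<in> {1..n} \<Longrightarrow> f (a i) = sA (t ^ 2 ^ i / core x i i i) (a i)"
    using diagonal_general_linear[OF vsA a, of "\<lambda>i. t ^ 2 ^ i / core x i i i"] x t by auto
  obtain g where g: "g \<in> general_linear sB" "\<And>i. i \<in> {1..n} \<Longrightarrow> g (b i) = sB (t ^ 2 ^ i) (b i)"
    using diagonal_general_linear[OF vsB b, of "\<lambda>i. t ^ 2 ^ i"] t by auto
  obtain h where h: "h \<in> general_linear sC" "\<And>i. i \<in> {1..n} \<Longrightarrow> h (c i) = sC (inverse (t ^ (2 * 2 ^ i))) (c i)"
    using diagonal_general_linear[OF vsC c, of "\<lambda>i. inverse (t ^ (2 * 2 ^ i))"] t by auto
  define f' g' h' where "f' = f \<circ> inv F" and "g' = g \<circ> inv G" and "h' = h \<circ> inv H"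
  have GL: "f' \<in> general_linear sA" "g' \<in> general_linear sB" "h' \<in> general_linear sC"
    unfolding f'_def g'_def h'_def using F G H f g h by (auto intro: general_linear_compose general_linear_inv)
  then have lin: "Vector_Spaces.linear sA sA f'" "Vector_Spaces.linear sB sB g'" "Vector_Spaces.linear sC sC h'"
    by (auto simp: general_linear_def)
  have inv: "inv F (vecA x i) = a i" "inv G (vecB x i) = b i" "inv H (vecC x i) = c i" if "i \<in> {1..n}" for i
    using F G H that by (auto simp: general_linear_def bij_is_inj simp flip: F(2) G(2) H(2))
  have f': "f' (vecA x i) = sA (t ^ 2 ^ i / core x i i i) (a i)" and g': "g' (vecB x i) = sB (t ^ 2 ^ i) (b i)"
    and h': "h' (vecC x i) = sC (inverse (t ^ (2 * 2 ^ i))) (c i)" if "i \<in> {1..n}" for i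
    using that by (simp_all add: f'_def g'_def h'_def inv f g h del: One_nat_def)
  let ?T = "tensor_map sV \<tau> f' g' h'"
  interpret V: vector_space sV by (rule vsV)
  have "?T (family x) = (\<Sum>i=1..n. \<Sum>j=1..n. \<Sum>k=1..n. sV (core x i j k) (\<tau> (f' (vecA x i)) (g' (vecB x j)) (h' (vecC x k))))"
    unfolding family_def
    by (simp only: linear_map_sum[OF tensor_map(1)[OF lin]] linear_map_scale[OF tensor_map(1)[OF lin]] tensor_map(2)[OF lin])
  also have "\<dots> = degeneration x t"
    unfolding degeneration_def
  proof (intro sum.cong refl)
    fix i j k assume ijk: "i \<in> {1..n}" "j \<in> {1..n}" "k \<in> {1..n}"
    have "t ^ (2 ^ i + 2 ^ j - 2 * 2 ^ k) = t ^ 2 ^ i * t ^ 2 ^ j * inverse (t ^ (2 * 2 ^ k))" if "k < max i j"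
      using power_diff[OF t, of "2 * 2 ^ k" "2 ^ i + 2 ^ j"] weight_pos[OF that]
      by (simp add: power_add divide_inverse)
    moreover have "t ^ 2 ^ k * t ^ 2 ^ k * inverse (t ^ (2 * 2 ^ k)) = 1"
      using t by (simp add: mult_2 power_add field_simps)
    ultimately have coeff: "core x i j k * (inverse (t ^ (2 * 2 ^ k)) * (t ^ 2 ^ j * (t ^ 2 ^ i / core x i i i))) =
       (if k < max i j then core x i j k / core x i i i * t ^ (2 ^ i + 2 ^ j - 2 * 2 ^ k)
         else if i = j \<and> j = k then 1 else 0)"
      using x[OF ijk(1)] by (auto simp: core_def field_simps)
    show "sV (core x i j k) (\<tau> (f' (vecA x i)) (g' (vecB x j)) (h' (vecC x k))) =
      sV (if k < max i j then core x i j k / core x i i i * t ^ (2 ^ i + 2 ^ j - 2 * 2 ^ k)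
         else if i = j \<and> j = k then 1 else 0) (\<tau> (a i) (b j) (c k))"
      unfolding f'[OF ijk(1)] g'[OF ijk(2)] h'[OF ijk(3)] linear_map_scale[OF linear_tensor(1)]
        linear_map_scale[OF linear_tensor(2)] linear_map_scale[OF linear_tensor(3)] V.scale_scale coeff[symmetric] ..
  qed
  finally have T: "?T (family x) = degeneration x t" .
  show "degeneration x t \<in> GL_orbit sA sB sC sV \<tau> (family x)"
    unfolding GL_orbit_def using GL T[symmetric] by blast
  \<comment> \<open>The coefficient of the degeneration at \<open>(1, 1, 1)\<close> is 1, so a
    linear image of \<open>family x\<close> is nonzero, and hence so is
    \<open>family x\<close>.\<close>
  have 1: "1 \<in> {1..n}" using n by simp
  have "coord 1 1 1 (degeneration x t) = (\<Sum>i=1..n. \<Sum>j=1..n. \<Sum>k=1..n.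
     (if k < max i j then core x i j k / core x i i i * t ^ (2 ^ i + 2 ^ j - 2 * 2 ^ k)
         else if i = j \<and> j = k then 1 else 0) *
     ((if 1 = i then 1 else 0) * (if 1 = j then 1 else 0) * (if 1 = k then 1 else 0)))"
    unfolding degeneration_def linear_map_sum[OF coord(1)[OF 1 1 1]] linear_map_scale[OF coord(1)[OF 1 1 1]]
      coord(2)[OF 1 1 1]
    by (intro sum.cong refl) (simp only: coordA(2)[OF 1] coordB(2)[OF 1] coordC(2)[OF 1])
  also have "\<dots> = 1" unfolding sum3_delta[OF 1 1 1] by simp
  finally have "degeneration x t \<noteq> 0" using linear_map_0[OF coord(1)[OF 1 1 1]] by auto
  then show "family x \<noteq> 0" using T linear_map_0[OF tensor_map(1)[OF lin]] by auto
qed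

text \<open>The limit of the degeneration at \<open>t = 0\<close> is the unit tensor of size
  \<open>n\<close>, the largest size that the supremum admits.\<close>

lemma border_subrank_family:
  assumes x: "disc x \<noteq> 0"
  shows "border_subrank sA sB sC sV \<tau> n a b c (family x) = n"
proof -
  have "degeneration x 0 \<in> zariski sV closure_of GL_orbit sA sB sC sV \<tau> (family x)"
  proof (rule curve_limit_in_zariski_closure)
    fix \<psi> assume \<psi>: "Vector_Spaces.linear sV (*) \<psi>"
    have "\<psi> (degeneration x t) = poly (\<Sum>i=1..n. \<Sum>j=1..n. \<Sum>k=1..n.
        smult (\<psi> (\<tau> (a i) (b j) (c k))) (if k < max i j then monom (core x i j k / core x i i i) (2 ^ i + 2 ^ j - 2 * 2 ^ k)
         else if i = j \<and> j = k then 1 else 0)) t" for t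
      unfolding degeneration_def linear_map_sum[OF \<psi>] linear_map_scale[OF \<psi>] poly_sum
      by (intro sum.cong refl) (simp add: poly_monom)
    then show "\<exists>P. \<forall>t. \<psi> (degeneration x t) = poly P t" by blast
  qed (rule degeneration_in_orbit(1)[OF x])
  then show ?thesis
    unfolding border_subrank_def degeneration_0 using n by (intro cSup_eq_maximum) auto
qed

section \<open>The dimension bound in terms of the number of parameters\<close>

lemma krull_dim_Q_max:
  "krull_dim (subtopology (proj_zariski sV) (Q_max sA sB sC sV \<tau> n a b c)) \<ge> ereal (real (card (params n)))"
proof -
  \<comment> \<open>That the family avoids 0 is read off from the degeneration at
    \<open>t = 1\<close>.\<close>
  interpret polynomial_family sV "params n" family disc 4 "\<Sum>i=1..n. 1"
    using vsV finite_params polys_family polys_disc disc_0 degeneration_in_orbit(2)[of _ 1]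
    by (intro polynomial_family.intro) auto
  have 1: "1 \<in> {1..n}" using n by simp
  \<comment> \<open>Diagonal coordinates equal 1 at the unit tensor; subtracting
    \<open>coord 1 1 1\<close> makes them vanish at the origin and keeps the forms linear.\<close>
  define y where "y = (\<lambda>(l, m, p) w. coord l m p w - (if l = m \<and> m = p then 1 else 0) * coord 1 1 1 w)"
  \<comment> \<open>Hence \<open>coord 1 1 1\<close> has derivative 0 at the origin, and the
    correction in \<open>y\<close> leaves the slope \<open>v i\<close> unchanged.\<close>
  have not_1: "(1, 1, 1) \<notin> params n" by (simp add: params_def)
  show ?thesis
  proof (rule krull_dim_ge_card)
    fix i assume i: "i \<in> params n"
    then obtain l m p where lmp: "i = (l, m, p)" "l \<in> {1..n}" "m \<in> {1..n}" "p \<in> {1..n}"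
      by (auto simp: params_def)
    note lin = coord(1)[OF lmp(2-4)] and lin1 = coord(1)[OF 1 1 1]
    show "Vector_Spaces.linear sV (*) (y i)"
      using lin lin1 by (simp add: Vector_Spaces.linear_iff y_def lmp(1) algebra_simps)
    fix v
    let ?f = "\<lambda>t. y i (family (\<lambda>i. t * v i))"
    have "(?f has_field_derivative v i) (at 0)"
      using DERIV_diff[OF DERIV_coord_family(1)[OF lmp(2-4)]
          DERIV_cmult[OF DERIV_coord_family(1)[OF 1 1 1], of "if l = m \<and> m = p then 1 else 0"]] i not_1
      by (simp add: y_def lmp(1) del: One_nat_def)
    moreover have "?f 0 = 0"
      unfolding y_def lmp(1) prod.case DERIV_coord_family(2)[OF lmp(2-4)] DERIV_coord_family(2)[OF 1 1 1] by simp
    ultimately show "((\<lambda>t. ?f t / t) \<longlongrightarrow> v i) (at 0)"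
      by (simp add: DERIV_def del: One_nat_def)
  next
    show "Vector_Spaces.linear sV (*) (coord 1 1 1)" by (rule coord(1)[OF 1 1 1])
  next
    fix v
    show "((\<lambda>t. coord 1 1 1 (family (\<lambda>i. t * v i))) \<longlongrightarrow> 1) (at 0)"
      using DERIV_isCont[OF DERIV_coord_family(1)[OF 1 1 1, of v]] DERIV_coord_family(2)[OF 1 1 1, of v]
      by (simp add: isCont_def del: One_nat_def)
  next
    show "closedin (proj_zariski sV) (Q_max sA sB sC sV \<tau> n a b c)"
      by (simp add: Q_max_def)
  next
    fix x assume x: "disc x \<noteq> 0"
    let ?S = "{proj_point sV T |T. T \<noteq> 0 \<and> border_subrank sA sB sC sV \<tau> n a b c T = n}"
    have "proj_point sV (family x) \<in> ?S"
      using border_subrank_family[OF x] degeneration_in_orbit(2)[OF x, of 1] by auto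
    moreover have "?S \<subseteq> topspace (proj_zariski sV)"
      unfolding topspace_proj_zariski[OF vsV] proj_space_def by blast
    ultimately show "proj_point sV (family x) \<in> Q_max sA sB sC sV \<tau> n a b c"
      unfolding Q_max_def using closure_of_subset by blast
  qed
qed

end

theorem theorem1p4:
  fixes n :: nat
    and sA :: "complex \<Rightarrow> 'a::ab_group_add \<Rightarrow> 'a"
    and sB :: "complex \<Rightarrow> 'b::ab_group_add \<Rightarrow> 'b"
    and sC :: "complex \<Rightarrow> 'c::ab_group_add \<Rightarrow> 'c"
    and sV :: "complex \<Rightarrow> 'v::ab_group_add \<Rightarrow> 'v"
    and \<tau> :: "'a \<Rightarrow> 'b \<Rightarrow> 'c \<Rightarrow> 'v"
    and a :: "nat \<Rightarrow> 'a" and b :: "nat \<Rightarrow> 'b" and c :: "nat \<Rightarrow> 'c"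
  assumes "n \<ge> 1"
    and "vector_space sA" and "vector_space.dim sA UNIV = n"
    and "vector_space sB" and "vector_space.dim sB UNIV = n"
    and "vector_space sC" and "vector_space.dim sC UNIV = n"
    and "vector_space sV" and "tensor_product sA sB sC sV \<tau>"
    and "basis_family sA n a" and "basis_family sB n b" and "basis_family sC n c"
  shows "krull_dim (subtopology (proj_zariski sV) (Q_max sA sB sC sV \<tau> n a b c))
           \<ge> ereal ((2 * real n ^ 3 + 3 * real n ^ 2 - 2 * real n - 3) / 3)"
proof -
  interpret tensor_bases n sA sB sC sV \<tau> a b c
    using assms by (intro tensor_bases.intro)
  show ?thesis using krull_dim_Q_max unfolding card_params[OF assms(1)] .
qed

end
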